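(* Let $S^1=\mathbb{R}/\mathbb{Z}$, let $d:S^1\to S^1$, $d(\theta)=2\theta$, be the angle-doubling map, let $g:S^1\to S^1$ be a continuous map homotopic to $d$, and let $\alpha:S^1\to S^1$ be its semiconjugacy to $d$. Then the following are equivalent: (a) There exists a point $\theta\in S^1$ with $\alpha^{-1}(\theta)$ disconnected. (b) There exists a full measure, dense, $G_\delta$-set $\Lambda\subset S^1$ such that for every $\theta\in\Lambda$ the set $\alpha^{-1}(\theta)$ has uncountably many connected components. (c) The map $\alpha$ is not of bounded variation. Further, when these equivalent conditions hold, the topological entropy of $g$ is strictly larger than that of $d$: $h_{top}(g)>h_{top}(d)=\log 2$.
   Context: For a continuous map $g:S^1\to S^1$ homotopic to $d$, there is a unique continuous map $\alpha:S^1\to S^1$ of degree one (i.e. homotopic to the identity) satisfying $\alpha\circ g=d\circ\alpha$; it is onto, and "the semiconjugacy of $g$ (to $d$)" always means this map $\alpha$. "Full measure" refers to Lebesgue measure on $S^1$. Bounded variation of the circle map $\alpha$ means that a lift $\tilde\alpha:\mathbb{R}\to\mathbb{R}$ of $\alpha$ has bounded variation on $[0,1]$. *)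

theory Defs
  imports "HOL-Analysis.Analysis"
begin

text \<open>
  The circle \<open>\<real>/\<int>\<close> is realised as the unit circle of the complex plane, the class of \<open>t\<close>
  being the point \<open>exp (2 \<pi> \<i> t)\<close>. Circle maps are functions on \<^typ>\<open>complex\<close>; only their
  values on the unit circle matter.
\<close>

abbreviation S1 :: "complex set" where
  "S1 \<equiv> sphere 0 1"

definition circle_proj :: "real \<Rightarrow> complex" where
  "circle_proj t = cis (2 * pi * t)"

text \<open>Under this identification \<open>\<theta> \<mapsto> 2 \<theta>\<close> becomes squaring.\<close>

definition doubling :: "complex \<Rightarrow> complex" where
  "doubling z = z\<^sup>2"

definition semiconjugacy :: "(complex \<Rightarrow> complex) \<Rightarrow> (complex \<Rightarrow> complex) \<Rightarrow> bool" where
  "semiconjugacy g \<alpha> \<longleftrightarrow>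
     continuous_on S1 \<alpha> \<and> \<alpha> ` S1 \<subseteq> S1 \<and>
     homotopic_with_canon (\<lambda>_. True) S1 S1 \<alpha> (\<lambda>z. z) \<and>
     (\<forall>z\<in>S1. \<alpha> (g z) = doubling (\<alpha> z))"

text \<open>Lebesgue measure on \<open>\<real>/\<int>\<close>, normalised to total mass 1.\<close>

definition circle_lebesgue :: "complex measure" where
  "circle_lebesgue =
     distr (restrict_space lborel {0..<1}) (restrict_space borel S1) circle_proj"

definition full_measure :: "complex set \<Rightarrow> bool" where
  "full_measure \<Lambda> \<longleftrightarrow> \<Lambda> \<subseteq> S1 \<and> S1 - \<Lambda> \<in> null_sets circle_lebesgue"

definition circle_lift :: "(complex \<Rightarrow> complex) \<Rightarrow> (real \<Rightarrow> real) \<Rightarrow> bool" where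
  "circle_lift f F \<longleftrightarrow>
     continuous_on UNIV F \<and> (\<forall>t. circle_proj (F t) = f (circle_proj t))"

definition bounded_variation_on :: "real \<Rightarrow> real \<Rightarrow> (real \<Rightarrow> real) \<Rightarrow> bool" where
  "bounded_variation_on a b F \<longleftrightarrow>
     (\<exists>B. \<forall>n t. mono_on {..n} t \<and> t ` {..n} \<subseteq> {a..b} \<longrightarrow>
        (\<Sum>i<n. \<bar>F (t (Suc i)) - F (t i)\<bar>) \<le> B)"

text \<open>Two lifts of the same map differ by an integer constant, so the choice of lift is immaterial.\<close>

definition circle_bounded_variation :: "(complex \<Rightarrow> complex) \<Rightarrow> bool" where
  "circle_bounded_variation f \<longleftrightarrow> (\<exists>F. circle_lift f F \<and> bounded_variation_on 0 1 F)"

text \<open>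
  Topological entropy of a continuous self-map \<open>f\<close> of a compact metric space \<open>X\<close>, by Bowen's
  \<open>(n,\<epsilon>)\<close>-separated sets. As \<^const>\<open>ln\<close> is monotone, the inner supremum is
  \<open>ln (s n \<epsilon>) / n\<close>, where \<open>s n \<epsilon>\<close> is the largest cardinality of an \<open>(n,\<epsilon>)\<close>-separated set.
  The value depends only on the topology of \<open>X\<close>, so it is the same for the chordal metric of
  the unit circle and for the metric of \<open>\<real>/\<int>\<close>.
\<close>

definition separated ::
  "'a::metric_space set \<Rightarrow> ('a \<Rightarrow> 'a) \<Rightarrow> nat \<Rightarrow> real \<Rightarrow> 'a set \<Rightarrow> bool" where
  "separated X f n \<epsilon> E \<longleftrightarrow>
     E \<subseteq> X \<and> (\<forall>x\<in>E. \<forall>y\<in>E. x \<noteq> y \<longrightarrow> (\<exists>i<n. dist ((f ^^ i) x) ((f ^^ i) y) > \<epsilon>))"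

definition topological_entropy :: "'a::metric_space set \<Rightarrow> ('a \<Rightarrow> 'a) \<Rightarrow> ereal" where
  "topological_entropy X f =
     (SUP \<epsilon>\<in>{0<..}. limsup (\<lambda>n.
        SUP E\<in>{E. finite E \<and> E \<noteq> {} \<and> separated X f n \<epsilon> E}. ereal (ln (real (card E)) / real n)))"

end

theory Submission
  imports Defs
begin

text \<open>
  On the line the situation becomes linear. The maps \<open>\<alpha>\<close> and \<open>g\<close> lift to continuous functions \<open>A\<close> and \<open>G\<close>
  with \<open>A (t + 1) = A t + 1\<close>, \<open>G (t + 1) = G t + 2\<close> and \<open>A (G t) = 2 * A t\<close>, and \<open>A\<close> stays at bounded
  distance from the identity. The fibre of \<open>\<alpha>\<close> over the class of \<open>x\<close> is homeomorphic to the compact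
  set of solutions of \<open>A t = x\<close>. If \<open>A\<close> is monotone, all these sets are intervals and \<open>A\<close> has variation
  \<open>1\<close> on a period. So everything follows once a single fold, that is a pair \<open>a < b\<close> with \<open>A b < A a\<close>, is
  shown to force fibres with uncountably many components over almost all angles, unbounded variation
  and large entropy.

  The source of all three is expansion: if \<open>A\<close> takes different values at the ends of an interval, then
  \<open>G ^^ n\<close> stretches that interval over a set of length about \<open>2 ^ n\<close> times the difference, and hence,
  for large \<open>n\<close>, over translates of the fold, whose shape can be pulled back into the interval.

  Fibres. Consider an \<open>x\<close> such that \<open>2 ^ n * x\<close> lies in a translate of \<open>(A b, A a)\<close> for infinitely many
  \<open>n\<close>. Pulling the fold back shows that every interval across which \<open>A\<close> passes the level \<open>x\<close> contains two
  disjoint intervals with the same property (\<open>crossing_splits\<close>). Iterating this as in Cantor's diagonal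
  argument gives uncountably many components of the fibre
  (\<open>not_countable_union_of_connected_fibre_parts\<close>). The set of such \<open>x\<close> is a countable intersection of
  open sets, and its complement has measure zero by a self-similarity argument
  (\<open>negligible_never_visiting\<close>).

  Variation and entropy. With a fold, \<open>A\<close> has total variation larger than \<open>1\<close> already on some interval
  \<open>[a, e]\<close> shorter than a period. Expansion therefore gives, for some \<open>n\<close>, more than \<open>2 ^ n\<close> disjoint
  subintervals of \<open>[a, e]\<close> that \<open>G ^^ n\<close> maps onto integer translates of \<open>[a, e]\<close> (\<open>horseshoe_exists\<close>).
  If there are \<open>N\<close> of them, then words of length \<open>k\<close> yield \<open>N ^ k\<close> disjoint intervals, each with an
  increment of \<open>A\<close> proportional to \<open>2 ^ (- n * k)\<close>, so the variation of \<open>A\<close> is at least of order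
  \<open>(N / 2 ^ n) ^ k\<close> for every \<open>k\<close>. Points following different words are separated within \<open>n * k\<close> steps of
  \<open>g\<close>, so the entropy of \<open>g\<close> is at least \<open>ln N / n\<close>, which exceeds \<open>ln 2\<close>.
\<close>

section \<open>The circle and lifts\<close>

lemma circle_proj_eq_iff: "circle_proj s = circle_proj t \<longleftrightarrow> (\<exists>k::int. s = t + of_int k)"
proof -
  have "circle_proj s = circle_proj t \<longleftrightarrow> sin (2 * pi * s) = sin (2 * pi * t) \<and> cos (2 * pi * s) = cos (2 * pi * t)"
    by (auto simp: circle_proj_def complex_eq_iff)
  also have "\<dots> \<longleftrightarrow> (\<exists>k::int. 2 * pi * s = 2 * pi * t + 2 * pi * of_int k)"
    by (rule sin_cos_eq_iff)
  also have "\<dots> \<longleftrightarrow> (\<exists>k::int. s = t + of_int k)"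
  proof -
    have "2 * pi * s = 2 * pi * t + 2 * pi * of_int k \<longleftrightarrow> s = t + of_int k" for k :: int
    proof -
      have "2 * pi * t + 2 * pi * of_int k = 2 * pi * (t + of_int k)"
        by (simp add: algebra_simps)
      then show ?thesis by simp
    qed
    then show ?thesis by simp
  qed
  finally show ?thesis .
qed

lemma circle_proj_add_int [simp]: "circle_proj (t + of_int k) = circle_proj t"
  by (auto simp: circle_proj_eq_iff)

lemma circle_proj_add_one [simp]: "circle_proj (t + 1) = circle_proj t"
  using circle_proj_add_int[of t 1] by simp

lemma circle_proj_in_S1 [simp]: "circle_proj t \<in> S1"
  by (simp add: circle_proj_def)

lemma norm_circle_proj [simp]: "norm (circle_proj t) = 1"
  by (simp add: circle_proj_def)

lemma S1_cases:
  assumes "z \<in> S1" obtains t where "z = circle_proj t" "0 \<le> t" "t < 1"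
proof -
  have "z = exp (\<i> * of_real (Arg2pi z))"
    using assms complex_norm_eq_1_exp by auto
  then have z: "z = circle_proj (Arg2pi z / (2 * pi))"
    by (simp add: circle_proj_def cis_conv_exp)
  have "0 \<le> Arg2pi z" "Arg2pi z < 2 * pi"
    by (auto simp: Arg2pi_ge_0 Arg2pi_lt_2pi)
  then show ?thesis using that[OF z] by auto
qed

lemma continuous_on_circle_proj [continuous_intros]:
  "continuous_on S f \<Longrightarrow> continuous_on S (\<lambda>t. circle_proj (f t))"
  unfolding circle_proj_def by (intro continuous_intros)

lemma doubling_circle_proj: "doubling (circle_proj t) = circle_proj (2 * t)"
  by (simp add: doubling_def circle_proj_def Complex.DeMoivre algebra_simps)

lemma doubling_funpow_circle_proj: "(doubling ^^ n) (circle_proj t) = circle_proj (2 ^ n * t)"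
  by (induction n) (simp_all add: doubling_circle_proj algebra_simps)

lemma doubling_funpow_in_S1: "z \<in> S1 \<Longrightarrow> (doubling ^^ n) z \<in> S1"
  by (metis S1_cases circle_proj_in_S1 doubling_funpow_circle_proj)

lemma continuous_on_doubling_funpow: "continuous_on S (doubling ^^ n)"
proof (induction n)
  case (Suc n)
  then show ?case
    unfolding doubling_def by (auto simp: o_def intro!: continuous_intros)
qed (auto simp: id_def)

text \<open>
  Distinct integers are at distance at least \<open>1\<close>, and the line is connected. This is why two lifts of
  the same map differ by an integer.
\<close>

lemma integer_valued_continuous_constant:
  fixes h :: "real \<Rightarrow> real"
  assumes "continuous_on UNIV h" "\<And>t. h t \<in> \<int>"
  obtains k :: int where "\<And>t. h t = of_int k"
proof -
  have "h constant_on UNIV"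
  proof (rule continuous_discrete_range_constant)
    fix x
    have "1 \<le> norm (h y - h x)" if "h y \<noteq> h x" for y
    proof -
      obtain m n :: int where "h y = of_int m" "h x = of_int n"
        using assms(2) by (metis Ints_cases)
      then have "h y - h x = of_int (m - n)" "m \<noteq> n" using that by auto
      moreover have "1 \<le> \<bar>m - n\<bar>" using \<open>m \<noteq> n\<close> by linarith
      ultimately show ?thesis by (metis norm_of_int of_int_1_le_iff of_int_abs)
    qed
    then show "\<exists>e>0. \<forall>y. y \<in> UNIV \<and> h y \<noteq> h x \<longrightarrow> e \<le> norm (h y - h x)"
      by (intro exI[of _ 1]) auto
  qed (use assms in auto)
  then obtain c where "\<And>t. h t = c" by (auto simp: constant_on_def)
  moreover obtain k :: int where "h 0 = of_int k" using assms(2) by (metis Ints_cases)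
  ultimately show ?thesis using that by metis
qed

lemma circle_lift_unique:
  assumes "circle_lift f F" "circle_lift f F'"
  obtains k :: int where "\<And>t. F t = F' t + of_int k"
proof -
  have "F t - F' t \<in> \<int>" for t
  proof -
    have "circle_proj (F t) = circle_proj (F' t)"
      using assms by (auto simp: circle_lift_def)
    then obtain k :: int where "F t = F' t + of_int k"
      by (auto simp: circle_proj_eq_iff)
    then show ?thesis by simp
  qed
  moreover have "continuous_on UNIV (\<lambda>t. F t - F' t)"
    using assms by (auto simp: circle_lift_def intro!: continuous_intros)
  ultimately obtain k :: int where "\<And>t. F t - F' t = of_int k"
    using integer_valued_continuous_constant by blast
  then show ?thesis using that by (metis add.commute diff_add_cancel)
qed

text \<open>
  If \<open>f\<close> is homotopic to \<open>z \<mapsto> z ^ n\<close>, the quotient \<open>f z / z ^ n\<close> is null-homotopic and hence has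
  a continuous logarithm \<open>\<i> \<phi>\<close> on the circle. Adding the periodic function given by \<open>\<phi> / (2 \<pi>)\<close> to
  \<open>n t\<close> yields the lift.
\<close>

lemma circle_lift_of_homotopic_power:
  assumes "homotopic_with_canon (\<lambda>_. True) S1 S1 f (\<lambda>z. z ^ n)"
  obtains F where "circle_lift f F" "\<And>t. F (t + 1) = F t + of_nat n"
proof -
  obtain c where "homotopic_with_canon (\<lambda>x. True) S1 S1 (\<lambda>x. f x / x ^ n) (\<lambda>x. c)"
    using homotopic_circlemaps_divide[THEN iffD1, OF assms] by blast
  then obtain \<phi> where \<phi>: "continuous_on S1 \<phi>" "\<And>x. x \<in> S1 \<Longrightarrow> f x / x ^ n = exp (\<i> * of_real (\<phi> x))"
    using inessential_eq_continuous_logarithm_circle[THEN iffD1, OF exI] by blast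
  define F where "F t = real n * t + \<phi> (circle_proj t) / (2 * pi)" for t
  have "continuous_on UNIV F"
    unfolding F_def
    by (intro continuous_intros continuous_on_compose2[OF \<phi>(1)]) auto
  moreover have "circle_proj (F t) = f (circle_proj t)" for t
  proof -
    have "circle_proj t ^ n \<noteq> 0"
      by (metis norm_circle_proj norm_zero power_not_zero zero_neq_one)
    then have "f (circle_proj t) = circle_proj t ^ n * exp (\<i> * of_real (\<phi> (circle_proj t)))"
      by (metis \<phi>(2) circle_proj_in_S1 mult.commute nonzero_divide_eq_eq)
    also have "circle_proj t ^ n = cis (2 * pi * (real n * t))"
      unfolding circle_proj_def by (simp only: Complex.DeMoivre) (simp add: mult_ac)
    also have "exp (\<i> * of_real (\<phi> (circle_proj t))) = cis (\<phi> (circle_proj t))"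
      by (simp only: cis_conv_exp)
    also have "cis (2 * pi * (real n * t)) * cis (\<phi> (circle_proj t)) = circle_proj (F t)"
      unfolding F_def circle_proj_def cis_mult by (simp add: distrib_left)
    finally show ?thesis by simp
  qed
  moreover have "F (t + 1) = F t + of_nat n" for t
    unfolding F_def by (simp add: distrib_left)
  ultimately show ?thesis using that by (auto simp: circle_lift_def)
qed

section \<open>Semiconjugacies on the line\<close>

locale doubling_semiconjugacy =
  fixes A G :: "real \<Rightarrow> real"
  assumes continuous_A: "continuous_on UNIV A" and continuous_G: "continuous_on UNIV G"
    and A_add_one: "A (t + 1) = A t + 1" and G_add_one: "G (t + 1) = G t + 2"
    and A_G: "A (G t) = 2 * A t"

lemma semiconjugacy_lift:
  assumes "homotopic_with_canon (\<lambda>_. True) S1 S1 g doubling" "semiconjugacy g \<alpha>"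
  obtains A G where "circle_lift \<alpha> A" "circle_lift g G" "doubling_semiconjugacy A G"
proof -
  have "homotopic_with_canon (\<lambda>_. True) S1 S1 \<alpha> (\<lambda>z. z ^ 1)"
    using assms by (simp add: semiconjugacy_def)
  then obtain A0 where A0: "circle_lift \<alpha> A0" "\<And>t. A0 (t + 1) = A0 t + 1"
    using circle_lift_of_homotopic_power by (metis of_nat_1)
  have "homotopic_with_canon (\<lambda>_. True) S1 S1 g (\<lambda>z. z ^ 2)"
    using assms by (simp add: doubling_def[abs_def])
  then obtain G where G: "circle_lift g G" "\<And>t. G (t + 1) = G t + 2"
    using circle_lift_of_homotopic_power by (metis of_nat_numeral)
  have "A0 (G t) - 2 * A0 t \<in> \<int>" for t
  proof -
    have "circle_proj (A0 (G t)) = circle_proj (2 * A0 t)"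
      using A0(1) G(1) assms(2) unfolding circle_lift_def semiconjugacy_def
      by (metis circle_proj_in_S1 doubling_circle_proj)
    then obtain k :: int where "A0 (G t) = 2 * A0 t + of_int k"
      by (auto simp: circle_proj_eq_iff)
    then show ?thesis by simp
  qed
  moreover have "continuous_on UNIV (\<lambda>t. A0 (G t) - 2 * A0 t)"
    using A0(1) G(1) unfolding circle_lift_def
    by (intro continuous_intros continuous_on_compose2[of UNIV A0 UNIV G]) auto
  ultimately obtain k :: int where k: "\<And>t. A0 (G t) - 2 * A0 t = of_int k"
    using integer_valued_continuous_constant by blast
  \<comment> \<open>A lift \<open>A0\<close> satisfies the equation up to an integer \<open>k\<close>; shifting it by \<open>k\<close> absorbs it.\<close>
  define A where "A t = A0 t + of_int k" for t
  have "circle_lift \<alpha> A"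
    using A0(1) unfolding circle_lift_def A_def by (auto intro!: continuous_intros)
  moreover have "doubling_semiconjugacy A G"
  proof
    show "continuous_on UNIV A" "continuous_on UNIV G"
      using \<open>circle_lift \<alpha> A\<close> G(1) by (auto simp: circle_lift_def)
    show "A (G t) = 2 * A t" for t using k[of t] by (simp add: A_def)
  qed (simp_all add: A_def A0(2) G(2))
  ultimately show ?thesis using that G(1) by blast
qed

section \<open>Intervals mapped exactly onto intervals\<close>

text \<open>
  Choose \<open>v\<close> as the first time the value \<open>d\<close> is reached and \<open>u\<close> as the last time before \<open>v\<close> at which the
  value is \<open>c\<close>; in between neither value can be passed.
\<close>

lemma exact_subinterval_increasing:
  fixes f :: "real \<Rightarrow> real"
  assumes f: "continuous_on {p..q} f" and "p \<le> q" "c < d" "f p = c" "f q = d"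
  obtains u v where "p \<le> u" "u < v" "v \<le> q" "f u = c" "f v = d" "f ` {u..v} = {c..d}"
proof -
  have "closed ({p..q} \<inter> f -` {d})"
    by (rule continuous_closed_preimage[OF f]) auto
  moreover have "{p..q} \<inter> f -` {d} = {t\<in>{p..q}. f t = d}" by auto
  ultimately have "compact {t\<in>{p..q}. f t = d}"
    by (simp add: compact_eq_bounded_closed bounded_subset[OF bounded_closed_interval[of p q]] subset_iff)
  then obtain v where v: "v \<in> {p..q}" "f v = d" and v_least: "\<And>t. t \<in> {p..q} \<Longrightarrow> f t = d \<Longrightarrow> v \<le> t"
    using compact_attains_inf[of "{t\<in>{p..q}. f t = d}"] assms by auto
  have fv: "continuous_on {p..v} f"
    using f v by (auto intro: continuous_on_subset)
  have "closed ({p..v} \<inter> f -` {c})"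
    by (rule continuous_closed_preimage[OF fv]) auto
  moreover have "{p..v} \<inter> f -` {c} = {t\<in>{p..v}. f t = c}" by auto
  ultimately have "compact {t\<in>{p..v}. f t = c}"
    by (simp add: compact_eq_bounded_closed bounded_subset[OF bounded_closed_interval[of p v]] subset_iff)
  then obtain u where u: "u \<in> {p..v}" "f u = c" and u_greatest: "\<And>t. t \<in> {p..v} \<Longrightarrow> f t = c \<Longrightarrow> t \<le> u"
    using compact_attains_sup[of "{t\<in>{p..v}. f t = c}"] assms v by fastforce
  have "u < v" using u v \<open>c < d\<close> by (cases "u = v") auto
  have fuv: "continuous_on {u..v} f"
    using fv u by (auto intro: continuous_on_subset)
  have "c \<le> f t \<and> f t \<le> d" if t: "t \<in> {u..v}" for t
  proof (intro conjI; rule ccontr)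
    assume "\<not> c \<le> f t"
    then obtain s where "t \<le> s" "s \<le> v" "f s = c"
      using IVT'[of f t c v] t u v \<open>c < d\<close> fuv by (force intro: continuous_on_subset)
    moreover have "s \<le> u" using u_greatest[of s] t u calculation by auto
    ultimately have "t = s" using t by auto
    with \<open>f s = c\<close> \<open>\<not> c \<le> f t\<close> show False by simp
  next
    assume "\<not> f t \<le> d"
    then obtain s where "u \<le> s" "s \<le> t" "f s = d"
      using IVT'[of f u d t] t u v \<open>c < d\<close> fuv by (force intro: continuous_on_subset)
    moreover have "v \<le> s" using v_least[of s] t u v calculation by auto
    ultimately have "t = s" using t by auto
    with \<open>f s = d\<close> \<open>\<not> f t \<le> d\<close> show False by simp
  qed
  moreover have "{c..d} \<subseteq> f ` {u..v}"
  proof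
    fix y assume "y \<in> {c..d}"
    then obtain s where "u \<le> s" "s \<le> v" "f s = y"
      using IVT'[of f u y v] u v \<open>u < v\<close> fuv by auto
    then show "y \<in> f ` {u..v}" by auto
  qed
  ultimately have "f ` {u..v} = {c..d}" by auto
  with that u v \<open>u < v\<close> show ?thesis by auto
qed

lemma exact_subinterval:
  fixes f :: "real \<Rightarrow> real"
  assumes f: "continuous_on {p..q} f" and "p \<le> q" "c < d"
    and "f p \<le> c \<and> d \<le> f q \<or> f q \<le> c \<and> d \<le> f p"
  obtains u v where "p \<le> u" "u < v" "v \<le> q" "f ` {u..v} = {c..d}" "{f u, f v} = {c, d}"
proof -
  have *: "\<exists>u v. p \<le> u \<and> u < v \<and> v \<le> q \<and> f ` {u..v} = {c..d} \<and> {f u, f v} = {c, d}"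
    if st: "s \<in> {p..q}" "t \<in> {p..q}" "f s = c" "f t = d" for s t
  proof (cases "s \<le> t")
    case True
    obtain u v where "s \<le> u" "u < v" "v \<le> t" "f u = c" "f v = d" "f ` {u..v} = {c..d}"
    proof (rule exact_subinterval_increasing)
      show "continuous_on {s..t} f" using st by (auto intro: continuous_on_subset[OF f])
    qed (use st True \<open>c < d\<close> in simp_all)
    with st show ?thesis by (intro exI[of _ u] exI[of _ v]) auto
  next
    case False
    obtain u v where uv: "- s \<le> u" "u < v" "v \<le> - t" "f (- u) = c" "f (- v) = d"
        "(\<lambda>x. f (- x)) ` {u..v} = {c..d}"
    proof (rule exact_subinterval_increasing[of "- s" "- t" "\<lambda>x. f (- x)" c d])
      show "continuous_on {- s..- t} (\<lambda>x. f (- x))"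
        by (rule continuous_on_compose2[OF f]) (use st in \<open>auto intro!: continuous_intros\<close>)
    qed (use st False \<open>c < d\<close> in simp_all)
    have "f ` {- v..- u} = (\<lambda>x. f (- x)) ` {u..v}"
      by (simp add: image_image[of f uminus, symmetric])
    with uv st show ?thesis by (intro exI[of _ "- v"] exI[of _ "- u"]) auto
  qed
  have "\<exists>s\<in>{p..q}. \<exists>t\<in>{p..q}. f s = c \<and> f t = d"
  proof (cases "f p \<le> c \<and> d \<le> f q")
    case True
    then obtain s t where "p \<le> s" "s \<le> q" "f s = c" "p \<le> t" "t \<le> q" "f t = d"
      using IVT'[of f p c q] IVT'[of f p d q] assms by auto
    then show ?thesis by (metis atLeastAtMost_iff)
  next
    case False
    then obtain s t where "p \<le> s" "s \<le> q" "f s = c" "p \<le> t" "t \<le> q" "f t = d"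
      using IVT2'[of f q c p] IVT2'[of f q d p] assms by auto
    then show ?thesis by (metis atLeastAtMost_iff)
  qed
  then show ?thesis using * that by meson
qed

section \<open>Folds of the semiconjugacy\<close>

context doubling_semiconjugacy
begin

lemma A_add_int: "A (t + of_int k) = A t + of_int k"
proof -
  have *: "A (t + of_nat n) = A t + of_nat n" for n t
  proof (induction n)
    case (Suc n)
    have "A (t + of_nat (Suc n)) = A ((t + of_nat n) + 1)" by (simp add: add_ac)
    then show ?case using Suc by (simp add: A_add_one)
  qed auto
  show ?thesis
  proof (cases k)
    case (nonneg n) then show ?thesis using * by simp
  next
    case (neg n)
    then have "t + of_int k = t - of_nat (Suc n)" by simp
    then show ?thesis using *[of "t - of_nat (Suc n)" "Suc n"] neg by (simp only:) simp
  qed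
qed

lemma G_add_int: "G (t + of_int k) = G t + 2 * of_int k"
proof -
  have *: "G (t + of_nat n) = G t + 2 * of_nat n" for n t
  proof (induction n)
    case (Suc n)
    have "G (t + of_nat (Suc n)) = G ((t + of_nat n) + 1)" by (simp add: add_ac)
    then show ?case using Suc by (simp add: G_add_one)
  qed auto
  show ?thesis
  proof (cases k)
    case (nonneg n) then show ?thesis using * by simp
  next
    case (neg n)
    then have "t + of_int k = t - of_nat (Suc n)" by simp
    then show ?thesis using *[of "t - of_nat (Suc n)" "Suc n"] neg by (simp only:) simp
  qed
qed

lemma funpow_G_add_int: "(G ^^ n) (t + of_int k) = (G ^^ n) t + 2 ^ n * of_int k"
proof (induction n)
  case (Suc n)
  then show ?case using G_add_int[of "(G ^^ n) t" "2 ^ n * k"] by simp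
qed auto

lemma A_funpow_G: "A ((G ^^ n) t) = 2 ^ n * A t"
  by (induction n) (simp_all add: A_G)

lemma continuous_funpow_G: "continuous_on S (G ^^ n)"
proof (induction n)
  case (Suc n)
  have "continuous_on S (\<lambda>x. G ((G ^^ n) x))"
    by (rule continuous_on_compose2[OF continuous_G Suc]) auto
  then show ?case by (simp add: o_def)
qed (simp add: id_def)

lemma continuous_A_on: "continuous_on S A"
  by (rule continuous_on_subset[OF continuous_A]) auto

text \<open>
  The difference \<open>A t - t\<close> is continuous and periodic, hence bounded. It turns information about
  values of \<^term>\<open>A\<close>, where the dynamics is exact doubling, into information about positions.
\<close>

lemma A_near_identity:
  obtains C where "C > 0" "\<And>t. \<bar>A t - t\<bar> \<le> C"
proof -
  have "compact ((\<lambda>t. A t - t) ` {0..1})"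
    by (intro compact_continuous_image continuous_intros continuous_A_on) auto
  then obtain C where C: "\<forall>t\<in>{0..1}. \<bar>A t - t\<bar> \<le> C"
    using compact_imp_bounded by (force simp: bounded_iff)
  have "\<bar>A t - t\<bar> \<le> max C 1" for t
  proof -
    have "A t = A (frac t) + of_int \<lfloor>t\<rfloor>"
      using A_add_int[of "frac t" "\<lfloor>t\<rfloor>"] by (simp add: frac_def)
    moreover have "\<bar>A (frac t) - frac t\<bar> \<le> C"
      using C by (simp add: frac_ge_0 less_imp_le[OF frac_lt_1])
    ultimately show ?thesis by (simp add: frac_def)
  qed
  then show ?thesis by (intro that[of "max C 1"]) auto
qed

lemma surj_A: obtains t where "A t = x"
proof -
  obtain C where C: "C > 0" "\<And>t. \<bar>A t - t\<bar> \<le> C" using A_near_identity by blast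
  have "A (x - C) \<le> x" "x \<le> A (x + C)"
    using C(2)[of "x - C"] C(2)[of "x + C"] by (simp_all add: abs_le_iff)
  then show ?thesis
    using IVT'[of A "x - C" x "x + C"] C that continuous_A_on by auto
qed

text \<open>
  Moving the right end of a descent to the left by an integer lowers the value of \<^term>\<open>A\<close> there, so
  the descent survives until it fits into one period.
\<close>

lemma fold_within_period:
  assumes "\<not> mono A"
  obtains a b where "0 \<le> a" "a < 1" "a < b" "b < a + 1" "A b < A a"
proof -
  obtain s t where st: "s \<le> t" "A t < A s" using assms by (auto simp: mono_def not_le)
  define a where "a = frac s"
  define b where "b = a + frac (t - s)"
  have "A a = A s - of_int \<lfloor>s\<rfloor>"
    using A_add_int[of a "\<lfloor>s\<rfloor>"] by (simp add: a_def frac_def)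
  moreover have "b + of_int (\<lfloor>s\<rfloor> + \<lfloor>t - s\<rfloor>) = t"
    by (simp add: a_def b_def frac_def)
  then have "A b = A t - of_int (\<lfloor>s\<rfloor> + \<lfloor>t - s\<rfloor>)"
    using A_add_int[of b "\<lfloor>s\<rfloor> + \<lfloor>t - s\<rfloor>"] by simp
  moreover have "0 \<le> real_of_int \<lfloor>t - s\<rfloor>" using st by simp
  ultimately have "A b < A a" using st(2) by linarith
  moreover have "a \<le> b" "b < a + 1" "0 \<le> a" "a < 1"
    by (auto simp: a_def b_def frac_ge_0 frac_lt_1)
  ultimately show ?thesis using that[of a b] by (cases "a = b") auto
qed

section \<open>Fibres with uncountably many components\<close>

text \<open>The pair \<open>J\<close> stands for the interval \<open>[fst J, snd J]\<close>.\<close>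

definition crossing :: "real \<Rightarrow> real \<times> real \<Rightarrow> bool" where
  "crossing x J \<longleftrightarrow> fst J < snd J \<and> (A (fst J) < x \<and> x < A (snd J) \<or> A (snd J) < x \<and> x < A (fst J))"

text \<open>
  The intervals \<open>[b - 1, a]\<close> and \<open>[b, a + 1]\<close> are disjoint and both cross every level in
  \<open>(A b, A a)\<close>. If \<open>2 ^ n * x\<close> lies in a translate of this range and \<open>n\<close> is large, the image of a
  given crossing interval under \<open>G ^^ n\<close> covers both translated intervals, and pulling them back
  splits the crossing.
\<close>

lemma crossing_splits:
  assumes ab: "a < b" "b < a + 1" "A b < A a"
    and visits: "\<And>N. \<exists>n\<ge>N. \<exists>m::int. A b + m < 2 ^ n * x \<and> 2 ^ n * x < A a + m"
    and J: "crossing x J"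
  obtains J1 J2 where "crossing x J1" "crossing x J2"
    "{fst J1..snd J1} \<subseteq> {fst J..snd J}" "{fst J2..snd J2} \<subseteq> {fst J..snd J}"
    "{fst J1..snd J1} \<inter> {fst J2..snd J2} = {}"
proof -
  obtain C where C: "C > 0" "\<And>t. \<bar>A t - t\<bar> \<le> C" using A_near_identity by blast
  define u v where "u = fst J" and "v = snd J"
  define \<delta> where "\<delta> = min \<bar>A u - x\<bar> \<bar>A v - x\<bar>"
  have "\<delta> > 0" using J by (auto simp: crossing_def u_def v_def \<delta>_def)
  then obtain N where N: "(2 * C + 1 + (A a - A b)) / \<delta> < 2 ^ N"
    using real_arch_pow[of 2] by auto
  obtain n m where "n \<ge> N" and m: "A b + of_int m < 2 ^ n * x" "2 ^ n * x < A a + of_int m"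
    using visits[of N] by auto
  have "(2::real) ^ N \<le> 2 ^ n" using \<open>n \<ge> N\<close> by simp
  then have "2 ^ n > (2 * C + 1 + (A a - A b)) / \<delta>" using N by linarith
  then have n: "2 ^ n * \<delta> > 2 * C + 1 + (A a - A b)" using \<open>\<delta> > 0\<close> by (simp add: field_simps)
  define f where "f = G ^^ n"
  have f: "continuous_on {u..v} f" unfolding f_def by (rule continuous_funpow_G)
  have fA: "A (f t) = 2 ^ n * A t" for t by (simp add: f_def A_funpow_G)
  have "u < v" using J by (simp add: crossing_def u_def v_def)
  \<comment> \<open>Points whose values are at least \<open>\<delta>\<close> away from \<open>x\<close> are carried beyond the two intervals to be covered.\<close>
  have low: "f w \<le> b - 1 + m" if "A w \<le> x - \<delta>" for w
  proof -
    have "f w \<le> 2 ^ n * A w + C" using C(2)[of "f w"] fA[of w] by linarith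
    also have "2 ^ n * A w \<le> 2 ^ n * (x - \<delta>)" using that by simp
    also have "\<dots> + C \<le> A b - 1 + m - C" using m n by (simp add: right_diff_distrib)
    also have "\<dots> \<le> b - 1 + m"
      using C(2)[of b] by linarith
    finally show ?thesis by simp
  qed
  have high: "a + 1 + m \<le> f w" if "A w \<ge> x + \<delta>" for w
  proof -
    have "a + 1 + m \<le> A a + C + 1 + m" using C(2)[of a] by linarith
    also have "\<dots> \<le> 2 ^ n * (x + \<delta>) - C" using m n by (simp add: distrib_left)
    also have "2 ^ n * (x + \<delta>) \<le> 2 ^ n * A w" using that by simp
    also have "2 ^ n * A w - C \<le> f w" using C(2)[of "f w"] fA[of w] by linarith
    finally show ?thesis by simp
  qed
  have ends: "f u \<le> b - 1 + m \<and> a + 1 + m \<le> f v \<or> f v \<le> b - 1 + m \<and> a + 1 + m \<le> f u"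
  proof (cases "A u < x")
    case True
    then have "A u \<le> x - \<delta>" "A v \<ge> x + \<delta>" using J by (auto simp: crossing_def u_def v_def \<delta>_def)
    then show ?thesis using low high by blast
  next
    case False
    then have "A v \<le> x - \<delta>" "A u \<ge> x + \<delta>" using J by (auto simp: crossing_def u_def v_def \<delta>_def)
    then show ?thesis using low high by blast
  qed
  have pull_back: "\<exists>I. crossing x I \<and> {fst I..snd I} \<subseteq> {u..v} \<and> f ` {fst I..snd I} = {c..d}"
    if cd: "c < d" "b - 1 + m \<le> c" "d \<le> a + 1 + m" and A_cd: "A c < 2 ^ n * x" "2 ^ n * x < A d" for c d
  proof -
    obtain u' v' where *: "u \<le> u'" "u' < v'" "v' \<le> v" "f ` {u'..v'} = {c..d}" "{f u', f v'} = {c, d}"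
      by (rule exact_subinterval[OF f, of c d]) (use \<open>u < v\<close> ends cd in auto)
    then have "A (f u') < 2 ^ n * x \<and> 2 ^ n * x < A (f v') \<or> A (f v') < 2 ^ n * x \<and> 2 ^ n * x < A (f u')"
      using A_cd by (auto simp: doubleton_eq_iff)
    then have "crossing x (u', v')" using * by (simp add: fA crossing_def)
    with * show ?thesis by (intro exI[of _ "(u', v')"]) auto
  qed
  have "A (b - 1 + m) = A b - 1 + m" "A (a + m) = A a + m" "A (b + m) = A b + m" "A (a + 1 + m) = A a + 1 + m"
    using A_add_int[of b "m - 1"] A_add_int[of a m] A_add_int[of b m] A_add_int[of a "m + 1"]
    by (simp_all add: algebra_simps)
  then obtain J1 J2 where J1: "crossing x J1" "{fst J1..snd J1} \<subseteq> {u..v}" "f ` {fst J1..snd J1} = {b - 1 + m..a + m}"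
    and J2: "crossing x J2" "{fst J2..snd J2} \<subseteq> {u..v}" "f ` {fst J2..snd J2} = {b + m..a + 1 + m}"
    using pull_back[of "b - 1 + m" "a + m"] pull_back[of "b + m" "a + 1 + m"] ab m by auto
  have "{fst J1..snd J1} \<inter> {fst J2..snd J2} = {}"
  proof (rule ccontr)
    assume "\<not> ?thesis"
    then obtain t where "t \<in> {fst J1..snd J1}" "t \<in> {fst J2..snd J2}" by blast
    then have "f t \<in> {b - 1 + m..a + m}" "f t \<in> {b + m..a + 1 + m}"
      using J1(3) J2(3) by blast+
    then show False using ab by simp
  qed
  with J1 J2 that show ?thesis by (simp add: u_def v_def)
qed

text \<open>
  A diagonal argument: a connected subset of the fibre misses one of the two halves of a split
  crossing, because an endpoint of a crossing interval lies outside the fibre. Hence countably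
  many connected subsets can be avoided one after the other, and a point of the fibre in the
  intersection of the nested crossings lies in none of them.
\<close>

lemma not_countable_union_of_connected_fibre_parts:
  assumes ab: "a < b" "b < a + 1" "A b < A a"
    and visits: "\<And>N. \<exists>n\<ge>N. \<exists>m::int. A b + m < 2 ^ n * x \<and> 2 ^ n * x < A a + m"
    and D: "\<And>n::nat. connected (D n)" "\<And>n. D n \<subseteq> A -` {x}"
  shows "\<exists>t\<in>A -` {x}. \<forall>n. t \<notin> D n"
proof -
  have avoid: "\<exists>I. (crossing x I \<and> {fst I..snd I} \<inter> D n = {}) \<and> {fst I..snd I} \<subseteq> {fst J..snd J}"
    if J: "crossing x J" for J n
  proof -
    obtain J1 J2 where J12: "crossing x J1" "crossing x J2"
      "{fst J1..snd J1} \<subseteq> {fst J..snd J}" "{fst J2..snd J2} \<subseteq> {fst J..snd J}"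
      "{fst J1..snd J1} \<inter> {fst J2..snd J2} = {}"
      using crossing_splits[OF ab visits J] by blast
    have "{fst J1..snd J1} \<inter> D n = {} \<or> {fst J2..snd J2} \<inter> D n = {}"
    proof (rule ccontr)
      assume "\<not> ?thesis"
      then obtain s t where st: "s \<in> {fst J1..snd J1}" "s \<in> D n" "t \<in> {fst J2..snd J2}" "t \<in> D n" by blast
      have hit: "r \<in> A -` {x}" if "min s t \<le> r" "r \<le> max s t" for r
        using connected_contains_Icc[OF D(1)[of n], of "min s t" "max s t"] st that D(2)[of n]
        by (auto simp: min_def max_def split: if_splits)
      have lt: "fst J1 < snd J1" "fst J2 < snd J2" using J12 by (auto simp: crossing_def)
      show False
      proof (cases "s \<le> t")
        case True
        then have "snd J1 < t" using J12(5) st lt by (auto simp: disjoint_iff not_le intro: ccontr)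
        then have "A (snd J1) = x" using hit[of "snd J1"] st True by auto
        then show False using J12(1) by (auto simp: crossing_def)
      next
        case False
        then have "snd J2 < s" using J12(5) st lt by (auto simp: disjoint_iff not_le intro: ccontr)
        then have "A (snd J2) = x" using hit[of "snd J2"] st False by auto
        then show False using J12(2) by (auto simp: crossing_def)
      qed
    qed
    then show ?thesis using J12 by blast
  qed
  obtain C where C: "C > 0" "\<And>t. \<bar>A t - t\<bar> \<le> C" using A_near_identity by blast
  have "crossing x (x - C - 1, x + C + 1)"
    using C(1) C(2)[of "x - C - 1"] C(2)[of "x + C + 1"] by (auto simp: crossing_def abs_le_iff)
  then have start: "\<exists>I. crossing x I \<and> {fst I..snd I} \<inter> D 0 = {}" using avoid by blast
  have "\<exists>J. \<forall>n. (crossing x (J n) \<and> {fst (J n)..snd (J n)} \<inter> D n = {}) \<and> {fst (J (Suc n))..snd (J (Suc n))} \<subseteq> {fst (J n)..snd (J n)}"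
    by (rule dependent_nat_choice[where P = "\<lambda>n J. crossing x J \<and> {fst J..snd J} \<inter> D n = {}"])
      (use start avoid in blast)+
  then obtain J where J: "\<And>n. crossing x (J n)" "\<And>n. {fst (J n)..snd (J n)} \<inter> D n = {}"
    "\<And>n. {fst (J (Suc n))..snd (J (Suc n))} \<subseteq> {fst (J n)..snd (J n)}" by blast
  define F where "F n = {fst (J n)..snd (J n)} \<inter> A -` {x}" for n
  have "\<Inter>(range F) \<noteq> {}"
  proof (rule compact_nest)
    show "compact (F n)" for n
      using continuous_closed_preimage[OF continuous_A_on, of "{fst (J n)..snd (J n)}" "{x}"]
      unfolding F_def by (intro compact_eq_bounded_closed[THEN iffD2] conjI bounded_subset[OF bounded_closed_interval]) auto
    show "F n \<noteq> {}" for n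
    proof -
      have "fst (J n) \<le> snd (J n)" using J(1)[of n] by (auto simp: crossing_def)
      then obtain t where "fst (J n) \<le> t" "t \<le> snd (J n)" "A t = x"
        using IVT'[of A "fst (J n)" x "snd (J n)"] IVT2'[of A "snd (J n)" x "fst (J n)"] J(1)[of n] continuous_A_on
        by (auto simp: crossing_def)
      then show ?thesis by (auto simp: F_def)
    qed
    show "F n \<subseteq> F m" if "m \<le> n" for m n
      using lift_Suc_antimono_le[of "\<lambda>n. {fst (J n)..snd (J n)}", OF J(3) that] by (auto simp: F_def)
  qed
  then obtain t where t: "\<And>n. t \<in> F n" by blast
  have "t \<notin> D n" for n using J(2)[of n] t[of n] by (simp only: F_def) blast
  with t show ?thesis by (auto simp: F_def)
qed

end

context doubling_semiconjugacy
begin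

text \<open>
  Since \<^term>\<open>A\<close> commutes with integer translations, each point of the circle over \<open>x\<close> is
  represented exactly once in \<open>A -` {x}\<close>, so the projection is a homeomorphism of this compact set
  onto the fibre.
\<close>

lemma fibre_eq_image:
  assumes "circle_lift \<alpha> A"
  shows "S1 \<inter> \<alpha> -` {circle_proj x} = circle_proj ` (A -` {x})"
proof (intro equalityI subsetI)
  fix z assume z: "z \<in> S1 \<inter> \<alpha> -` {circle_proj x}"
  then obtain t where t: "z = circle_proj t" by (metis IntD1 S1_cases)
  then have "circle_proj (A t) = circle_proj x" using z assms by (simp add: circle_lift_def)
  then obtain k :: int where "A t = x + of_int k" by (auto simp: circle_proj_eq_iff)
  then have "A (t + of_int (- k)) = x" unfolding A_add_int by simp
  moreover have "z = circle_proj (t + of_int (- k))" by (simp only: circle_proj_add_int t)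
  ultimately show "z \<in> circle_proj ` (A -` {x})" by blast
next
  fix z assume "z \<in> circle_proj ` (A -` {x})"
  then show "z \<in> S1 \<inter> \<alpha> -` {circle_proj x}"
    using assms by (auto simp: circle_lift_def)
qed

lemma inj_on_circle_proj_fibre: "inj_on circle_proj (A -` {x})"
proof (rule inj_onI)
  fix s t assume st: "s \<in> A -` {x}" "t \<in> A -` {x}" "circle_proj s = circle_proj t"
  then obtain k :: int where "s = t + of_int k" by (auto simp: circle_proj_eq_iff)
  then show "s = t" using st A_add_int[of t k] by simp
qed

lemma compact_fibre: "compact (A -` {x})"
proof -
  obtain C where C: "C > 0" "\<And>t. \<bar>A t - t\<bar> \<le> C" using A_near_identity by blast
  have "x - C \<le> t \<and> t \<le> x + C" if "A t = x" for t
    using C(2)[of t] that by linarith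
  then have "A -` {x} \<subseteq> {x - C..x + C}" by auto
  moreover have "closed (A -` {x})"
    using continuous_closed_vimage[of "{x}" A] continuous_A
    by (simp add: continuous_on_eq_continuous_at)
  ultimately show ?thesis
    by (meson bounded_closed_interval bounded_subset compact_eq_bounded_closed)
qed

lemma uncountable_components_fibre:
  assumes \<alpha>: "circle_lift \<alpha> A" and ab: "a < b" "b < a + 1" "A b < A a"
    and visits: "\<And>N. \<exists>n\<ge>N. \<exists>m::int. A b + m < 2 ^ n * x \<and> 2 ^ n * x < A a + m"
  shows "uncountable (components (S1 \<inter> \<alpha> -` {circle_proj x}))"
proof
  let ?Q = "A -` {x}" and ?F = "S1 \<inter> \<alpha> -` {circle_proj x}"
  have "\<exists>q. homeomorphism ?Q ?F circle_proj q"
    by (rule homeomorphism_compact[OF compact_fibre])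
      (simp_all add: fibre_eq_image[OF \<alpha>] inj_on_circle_proj_fibre continuous_on_circle_proj)
  then obtain q where hom: "homeomorphism ?Q ?F circle_proj q" ..
  have q: "continuous_on ?F q" "q ` ?F = ?Q" "\<And>t. t \<in> ?Q \<Longrightarrow> q (circle_proj t) = t"
    using homeomorphism_cont2[OF hom] homeomorphism_image2[OF hom] homeomorphism_apply1[OF hom]
    by blast+
  assume "countable (components ?F)"
  moreover have "components ?F \<noteq> {}"
  proof -
    obtain t where "A t = x" by (rule surj_A)
    then show ?thesis
      unfolding components_eq_empty fibre_eq_image[OF \<alpha>] by blast
  qed
  ultimately have "range (from_nat_into (components ?F)) = components ?F"
    by (intro range_from_nat_into)
  then obtain E :: "nat \<Rightarrow> complex set" where E: "range E = components ?F" ..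
  have "q ` E n \<subseteq> ?Q \<and> connected (q ` E n)" for n
  proof -
    have "E n \<in> components ?F" using E by blast
    then have "E n \<subseteq> ?F" "connected (E n)"
      using in_components_subset in_components_connected by auto
    then show ?thesis
      using q(2) connected_continuous_image[OF continuous_on_subset[OF q(1)]] by blast
  qed
  then obtain t where t: "t \<in> ?Q" "\<And>n. t \<notin> q ` E n"
    using not_countable_union_of_connected_fibre_parts[OF ab visits, of "\<lambda>n. q ` E n"] by auto
  have "circle_proj t \<in> ?F"
    using t(1) by (simp only: fibre_eq_image[OF \<alpha>] imageI)
  then have "circle_proj t \<in> \<Union> (range E)"
    unfolding E Union_components .
  then obtain n where "circle_proj t \<in> E n" by blast
  then have "q (circle_proj t) \<in> q ` E n" by (rule imageI)
  then show False using t q(3) by metis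
qed

lemma connected_fibre_if_mono:
  assumes "circle_lift \<alpha> A" "mono A" "\<theta> \<in> S1"
  shows "connected (S1 \<inter> \<alpha> -` {\<theta>})"
proof -
  obtain x where x: "\<theta> = circle_proj x" using assms(3) by (metis S1_cases)
  have "A t = x" if "A r = x" "A s = x" "r \<le> t" "t \<le> s" for r s t
    using monoD[OF \<open>mono A\<close>, of r t] monoD[OF \<open>mono A\<close>, of t s] that by simp
  then have "is_interval (A -` {x})"
    unfolding is_interval_1 vimage_singleton_eq by blast
  then have "connected (circle_proj ` (A -` {x}))"
    by (intro connected_continuous_image continuous_on_circle_proj continuous_on_id is_interval_connected)
  then show ?thesis by (simp only: x fibre_eq_image[OF assms(1)])
qed

end

section \<open>Orbits of the doubling map visiting an interval infinitely often\<close>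

text \<open>
  Let \<open>W\<close> be the union of the integer translates of \<open>(p, q)\<close>.
  The set of points whose orbit never meets \<open>W\<close> is forward invariant, and a dyadic interval of
  length \<open>2 ^ -P\<close> inside \<open>W\<close> is missing from it. So the part of it in a unit interval is covered by
  \<open>2 ^ P - 1\<close> copies of itself, scaled by \<open>2 ^ -P\<close>; this is impossible for positive measure.
\<close>

lemma negligible_never_visiting:
  fixes p q :: real
  assumes "p < q"
  shows "negligible {x. \<forall>n. \<forall>m::int. \<not> (p + m < 2 ^ n * x \<and> 2 ^ n * x < q + m)}" (is "negligible ?F")
proof -
  have F_shift: "x + of_int k \<in> ?F" if "x \<in> ?F" for x and k :: int
  proof -
    have "\<not> (p + m < 2 ^ n * (x + k) \<and> 2 ^ n * (x + k) < q + m)" for n and m :: int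
    proof -
      have "\<not> (p + (m - 2 ^ n * k) < 2 ^ n * x \<and> 2 ^ n * x < q + (m - 2 ^ n * k))"
        using that[simplified, rule_format, of "m - 2 ^ n * k" n] by simp
      then show ?thesis by (simp add: algebra_simps)
    qed
    then show ?thesis by blast
  qed
  have F_scale: "2 ^ j * x \<in> ?F" if "x \<in> ?F" for x j
  proof -
    have "\<not> (p + m < 2 ^ n * (2 ^ j * x) \<and> 2 ^ n * (2 ^ j * x) < q + m)" for n and m :: int
      using that[simplified, rule_format, of m "n + j"] by (simp add: power_add mult.assoc)
    then show ?thesis by blast
  qed
  have F_closed: "closed ?F"
    by (intro closed_Collect_all closed_Collect_neg open_Collect_conj open_Collect_less continuous_intros)
  define E where "E = ?F \<inter> {0..<1}"
  have E_borel: "E \<in> sets borel" using F_closed by (simp add: E_def borel_closed)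
  then have E_sets: "E \<in> sets lebesgue" by (simp add: sets_completionI_sets)
  have "E \<subseteq> {0..1}" by (auto simp: E_def)
  then have E: "E \<in> lmeasurable" using E_sets by (intro bounded_set_imp_lmeasurable bounded_subset[OF bounded_closed_interval]) auto
  obtain P where P: "2 / (q - p) < 2 ^ P" using real_arch_pow[of 2] by auto
  define M :: int where "M = 2 ^ P"
  have "M > 0" by (simp add: M_def)
  have PM: "2 < M * (q - p)" using P assms by (simp add: M_def field_simps)
  define k where "k = \<lfloor>M * p\<rfloor> + 1"
  have k: "M * p < k" "k + 1 < M * q"
    using PM unfolding k_def by (simp_all add: algebra_simps) linarith+
  define r where "r = k mod M"
  have r: "0 \<le> r" "r < M" using \<open>M > 0\<close> by (auto simp: r_def)
  have gap: "x \<notin> ?F" if "r \<le> M * x" "M * x < r + 1" for x :: real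
  proof
    assume "x \<in> ?F"
    then have "x + (k div M) \<in> ?F" by (rule F_shift)
    from this[simplified, rule_format, of 0 0] have "\<not> (p < x + (k div M) \<and> x + (k div M) < q)"
      by simp
    moreover have kr: "real_of_int k = real_of_int M * real_of_int (k div M) + real_of_int r"
      unfolding r_def by (metis mult_div_mod_eq of_int_add of_int_mult)
    have "M * p < M * (x + (k div M))" "M * (x + (k div M)) < M * q"
      using k that kr unfolding distrib_left by linarith+
    then have "p < x + (k div M)" "x + (k div M) < q" using \<open>M > 0\<close> by simp_all
    ultimately show False by blast
  qed
  have cover: "E \<subseteq> (\<Union>i\<in>{0..<M} - {r}. (\<lambda>y. (1 / M) *\<^sub>R y + i / M) ` E)"
  proof
    fix x assume x: "x \<in> E"
    define i where "i = \<lfloor>M * x\<rfloor>"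
    have "0 \<le> i" "i < M"
      using x \<open>M > 0\<close> by (auto simp: i_def E_def floor_less_iff)
    have "2 ^ P * x + of_int (- i) \<in> ?F" using x by (intro F_shift F_scale) (simp add: E_def)
    then have "M * x - i \<in> E"
      using of_int_floor_le[of "M * x"] floor_correct[of "M * x"] by (simp add: E_def M_def i_def) linarith
    moreover have "x = (1 / M) *\<^sub>R (M * x - i) + i / M" using \<open>M > 0\<close> by (simp add: field_simps)
    moreover have "i \<noteq> r"
    proof
      assume "i = r"
      then have "r \<le> M * x" "M * x < r + 1" using floor_correct[of "M * x"] by (auto simp: i_def)
      with gap x show False by (auto simp: E_def)
    qed
    ultimately show "x \<in> (\<Union>i\<in>{0..<M} - {r}. (\<lambda>y. (1 / M) *\<^sub>R y + i / M) ` E)"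
      using \<open>0 \<le> i\<close> \<open>i < M\<close> by (intro UN_I[of i]) auto
  qed
  have affine: "measure lebesgue ((\<lambda>y. (1 / M) *\<^sub>R y + i / M) ` E) = measure lebesgue E / M"
    "(\<lambda>y. (1 / M) *\<^sub>R y + i / M) ` E \<in> lmeasurable" for i :: int
  proof -
    show "measure lebesgue ((\<lambda>y. (1 / M) *\<^sub>R y + i / M) ` E) = measure lebesgue E / M"
      using measure_lebesgue_affine[of "1 / M" "i / M" E] \<open>M > 0\<close> by simp
    have "(\<lambda>y. (1 / M) *\<^sub>R y + i / M) ` E = (\<lambda>x::real. M * x - i) -` E \<inter> space borel"
    proof (intro equalityI subsetI)
      fix x assume "x \<in> (\<lambda>x::real. M * x - i) -` E \<inter> space borel"
      then show "x \<in> (\<lambda>y. (1 / M) *\<^sub>R y + i / M) ` E"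
        using \<open>M > 0\<close> by (intro image_eqI[of _ _ "M * x - i"]) (auto simp: field_simps)
    qed (use \<open>M > 0\<close> in \<open>auto simp: field_simps\<close>)
    also have "\<dots> \<in> sets borel"
      by (rule measurable_sets[OF _ E_borel]) simp
    finally have "(\<lambda>y. (1 / M) *\<^sub>R y + i / M) ` E \<in> sets lebesgue"
      by (simp add: sets_completionI_sets)
    moreover have "emeasure lebesgue ((\<lambda>y. (1 / M) *\<^sub>R y + i / M) ` E) < \<infinity>"
      using fmeasurableD2[OF E] emeasure_lebesgue_affine[of "1 / M" "i / M" E]
      by (simp add: ennreal_mult_less_top top.not_eq_extremum)
    ultimately show "(\<lambda>y. (1 / M) *\<^sub>R y + i / M) ` E \<in> lmeasurable"
      by (intro fmeasurableI)
  qed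
  have "measure lebesgue E \<le> measure lebesgue (\<Union>i\<in>{0..<M} - {r}. (\<lambda>y. (1 / M) *\<^sub>R y + i / M) ` E)"
    using affine(2) E_sets by (intro measure_mono_fmeasurable cover fmeasurable.finite_UN) auto
  also have "\<dots> \<le> (\<Sum>i\<in>{0..<M} - {r}. measure lebesgue E / M)"
    by (rule order_trans[OF measure_UNION_le]) (use affine in \<open>auto simp: fmeasurableD\<close>)
  also have "\<dots> = (M - 1) * (measure lebesgue E / M)"
    using r \<open>M > 0\<close> by (simp add: card_Diff_subset of_nat_diff nat_le_iff)
  finally have "measure lebesgue E \<le> 0" using \<open>M > 0\<close> by (simp add: field_simps)
  then have "measure lebesgue E = 0" by (simp add: measure_le_0_iff)
  then have "negligible E" using E by (simp add: negligible_iff_measure)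
  have "?F \<subseteq> (\<Union>k::int. (+) (of_int k) ` E)"
  proof
    fix x assume "x \<in> ?F"
    then have "x + of_int (- \<lfloor>x\<rfloor>) \<in> E"
      using F_shift[of x "- \<lfloor>x\<rfloor>"] floor_correct[of x] by (simp add: E_def) linarith
    then have "x \<in> (+) (of_int \<lfloor>x\<rfloor>) ` E" by (intro image_eqI[of _ _ "x + of_int (- \<lfloor>x\<rfloor>)"]) auto
    then show "x \<in> (\<Union>k::int. (+) (of_int k) ` E)" by blast
  qed
  moreover have "negligible (\<Union>k::int. (+) (of_int k :: real) ` E)"
    using \<open>negligible E\<close> by (intro negligible_countable_Union) (auto intro: negligible_translation)
  ultimately show ?thesis using negligible_subset by blast
qed

lemma negligible_not_visiting_infinitely_often:
  fixes p q :: real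
  assumes "p < q"
  shows "negligible {x. \<not> (\<forall>N. \<exists>n\<ge>N. \<exists>m::int. p + m < 2 ^ n * x \<and> 2 ^ n * x < q + m)}" (is "negligible ?B")
proof -
  let ?F = "{x. \<forall>n. \<forall>m::int. \<not> (p + m < 2 ^ n * x \<and> 2 ^ n * x < q + m)}"
  have "?B \<subseteq> (\<Union>N. (\<lambda>y. y / 2 ^ N) ` ?F)"
  proof
    fix x assume "x \<in> ?B"
    then obtain N where N: "\<And>n m. n \<ge> N \<Longrightarrow> \<not> (p + of_int m < 2 ^ n * x \<and> 2 ^ n * x < q + of_int m)" by blast
    have "2 ^ N * x \<in> ?F"
      using N[of "n + N" for n] by (simp add: power_add mult.assoc)
    then show "x \<in> (\<Union>N. (\<lambda>y. y / 2 ^ N) ` ?F)"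
      by (intro UN_I[of N] image_eqI[of _ _ "2 ^ N * x"]) auto
  qed
  moreover have "negligible ((\<lambda>y. y / 2 ^ N) ` ?F)" for N
    by (intro negligible_differentiable_image_negligible negligible_never_visiting assms
          bounded_linear_imp_differentiable_on bounded_linear_divide) auto
  then have "negligible (\<Union>N. (\<lambda>y. y / 2 ^ N) ` ?F)"
    by (intro negligible_countable_Union) auto
  ultimately show ?thesis using negligible_subset by blast
qed

text \<open>
  The image of a short open interval under the projection is the complement of the compact image of
  the rest of a period.
\<close>

lemma openin_circle_proj_interval:
  assumes "p < q" "q < p + 1"
  shows "openin (top_of_set S1) (circle_proj ` {p<..<q})"
proof -
  have disj: "circle_proj s \<noteq> circle_proj t" if "s \<in> {p<..<q}" "t \<in> {q..p + 1}" for s t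
  proof
    assume "circle_proj s = circle_proj t"
    then obtain k :: int where "s = t + of_int k" by (auto simp: circle_proj_eq_iff)
    then have "-1 < real_of_int k" "real_of_int k < 0" using that assms by auto
    then have "-1 < k" "k < 0" by linarith+
    then show False by simp
  qed
  have "circle_proj ` {p<..<q} = S1 - circle_proj ` {q..p + 1}"
  proof (intro equalityI subsetI)
    fix z assume "z \<in> S1 - circle_proj ` {q..p + 1}"
    then have z: "z \<in> S1" "z \<notin> circle_proj ` {q..p + 1}" by auto
    obtain t where t: "z = circle_proj t" by (rule S1_cases[OF z(1)])
    define s where "s = p + frac (t - p)"
    have "s = t + of_int (- \<lfloor>t - p\<rfloor>)" by (simp add: s_def frac_def)
    then have zs: "z = circle_proj s" by (simp only: circle_proj_add_int t)
    have "p \<le> s" "s < p + 1" by (auto simp: s_def frac_lt_1)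
    moreover have "s \<notin> {q..p + 1}" using z(2) zs by blast
    moreover have "s \<noteq> p"
    proof
      assume "s = p"
      then have "z = circle_proj (p + 1)" using zs by simp
      moreover have "p + 1 \<in> {q..p + 1}" using assms by simp
      ultimately show False using z(2) by blast
    qed
    ultimately have "s \<in> {p<..<q}" by auto
    then show "z \<in> circle_proj ` {p<..<q}" using zs by blast
  next
    fix z assume "z \<in> circle_proj ` {p<..<q}"
    then obtain s where s: "s \<in> {p<..<q}" "z = circle_proj s" by blast
    have "z \<notin> circle_proj ` {q..p + 1}"
    proof
      assume "z \<in> circle_proj ` {q..p + 1}"
      then obtain t where "z = circle_proj t" "t \<in> {q..p + 1}" by (rule imageE)
      then show False using disj[OF s(1)] s(2) by metis
    qed
    then show "z \<in> S1 - circle_proj ` {q..p + 1}" using s(2) by simp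
  qed
  moreover have "compact (circle_proj ` {q..p + 1})"
    by (intro compact_continuous_image continuous_on_circle_proj continuous_on_id) simp
  ultimately have "circle_proj ` {p<..<q} = S1 \<inter> - circle_proj ` {q..p + 1}"
      "open (- circle_proj ` {q..p + 1})"
    by (auto simp: compact_imp_closed open_Compl)
  then show ?thesis by (metis openin_open_Int)
qed

lemma circle_proj_visits_iff:
  "(doubling ^^ n) (circle_proj x) \<in> circle_proj ` {p<..<q} \<longleftrightarrow>
     (\<exists>m::int. p + m < 2 ^ n * x \<and> 2 ^ n * x < q + m)" (is "?L = ?R")
proof
  assume ?L
  then obtain s where s: "p < s" "s < q" "circle_proj (2 ^ n * x) = circle_proj s"
    by (auto simp: doubling_funpow_circle_proj)
  then obtain m :: int where "2 ^ n * x = s + of_int m" by (auto simp: circle_proj_eq_iff)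
  then show ?R using s by (intro exI[of _ m]) simp
next
  assume ?R
  then obtain m :: int where m: "p + m < 2 ^ n * x" "2 ^ n * x < q + m" by blast
  have "2 ^ n * x + of_int (- m) \<in> {p<..<q}" using m by simp
  then have "circle_proj (2 ^ n * x + of_int (- m)) \<in> circle_proj ` {p<..<q}" by (rule imageI)
  then show ?L unfolding doubling_funpow_circle_proj circle_proj_add_int .
qed

lemma measurable_circle_proj:
  "circle_proj \<in> measurable (restrict_space lborel {0..<1}) (restrict_space borel S1)"
proof -
  have "circle_proj \<in> borel_measurable borel"
    by (intro borel_measurable_continuous_onI continuous_on_circle_proj continuous_on_id)
  then have "circle_proj \<in> measurable (restrict_space lborel {0..<1}) borel"
    by (intro measurable_restrict_space1) simp
  then show ?thesis
    by (intro measurable_restrict_space2) auto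
qed

text \<open>
  To be visited after time \<open>N\<close> is an open condition for every \<open>N\<close>, which gives a \<open>G\<close>-delta set. A null
  set contains no arc, so density follows from full measure.
\<close>

lemma infinitely_often_visiting_residual_full_measure:
  fixes p q :: real
  assumes "p < q" "q < p + 1"
  defines "\<Lambda> \<equiv> {z\<in>S1. \<forall>N. \<exists>n\<ge>N. (doubling ^^ n) z \<in> circle_proj ` {p<..<q}}"
  shows "full_measure \<Lambda>" "top_of_set S1 closure_of \<Lambda> = S1" "gdelta_in (top_of_set S1) \<Lambda>"
proof -
  define V where "V n = S1 \<inter> (doubling ^^ n) -` (circle_proj ` {p<..<q})" for n
  have V: "openin (top_of_set S1) (V n)" for n
    unfolding V_def using doubling_funpow_in_S1
    by (intro continuous_openin_preimage[OF continuous_on_doubling_funpow _ openin_circle_proj_interval] assms) auto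
  have eq: "\<Lambda> = (\<Inter>N. \<Union>n\<in>{N..}. V n)"
    unfolding \<Lambda>_def V_def by fastforce
  show gdelta: "gdelta_in (top_of_set S1) \<Lambda>"
    unfolding eq by (intro gdelta_in_Inter open_imp_gdelta_in) (auto intro: V)
  have proj_\<Lambda>: "circle_proj x \<in> \<Lambda> \<longleftrightarrow> (\<forall>N. \<exists>n\<ge>N. \<exists>m::int. p + m < 2 ^ n * x \<and> 2 ^ n * x < q + m)" for x
    unfolding \<Lambda>_def mem_Collect_eq circle_proj_visits_iff by simp
  have neg: "negligible {x. circle_proj x \<notin> \<Lambda>}"
    unfolding proj_\<Lambda> using negligible_not_visiting_infinitely_often[OF assms(1)] .
  have "V n \<in> sets (restrict_space borel S1)" for n
  proof -
    obtain T where "open T" "V n = S1 \<inter> T" using V[of n] by (auto simp: openin_open)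
    then show ?thesis by (auto simp: sets_restrict_space)
  qed
  then have \<Lambda>_sets: "\<Lambda> \<in> sets (restrict_space borel S1)"
    unfolding eq by (intro sets.countable_INT sets.countable_UN'') auto
  have S1_sets: "S1 - \<Lambda> \<in> sets (restrict_space borel S1)"
    using sets.compl_sets[OF \<Lambda>_sets] by (simp add: space_restrict_space)
  have "circle_proj -` (S1 - \<Lambda>) \<inter> {0..<1} \<in> null_sets lborel"
  proof -
    have "circle_proj -` (S1 - \<Lambda>) \<inter> {0..<1} \<in> sets (restrict_space lborel {0..<1})"
      using measurable_sets[OF measurable_circle_proj S1_sets] by (simp add: space_restrict_space)
    then have "circle_proj -` (S1 - \<Lambda>) \<inter> {0..<1} \<in> sets lborel"
      by (auto simp: sets_restrict_space)
    moreover have "negligible (circle_proj -` (S1 - \<Lambda>) \<inter> {0..<1})"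
      by (rule negligible_subset[OF neg]) auto
    ultimately show ?thesis by (simp add: negligible_iff_null_sets null_sets_completion_iff)
  qed
  then have "circle_proj -` (S1 - \<Lambda>) \<inter> {0..<1} \<in> null_sets (restrict_space lborel {0..<1})"
    by (subst null_sets_restrict_space) auto
  then show "full_measure \<Lambda>"
    unfolding full_measure_def circle_lebesgue_def null_sets_distr_iff[OF measurable_circle_proj]
    using S1_sets by (auto simp: space_restrict_space \<Lambda>_def)
  have "z \<in> closure \<Lambda>" if z: "z \<in> S1" for z
  proof -
    obtain t where t: "z = circle_proj t" by (rule S1_cases[OF z])
    have "closure {x. circle_proj x \<in> \<Lambda>} = UNIV"
    proof -
      have "interior {x. circle_proj x \<notin> \<Lambda>} = {}"
      proof (rule ccontr)
        assume "interior {x. circle_proj x \<notin> \<Lambda>} \<noteq> {}"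
        then show False
          using open_not_negligible[OF open_interior] negligible_subset[OF neg interior_subset] by blast
      qed
      moreover have "- {x. circle_proj x \<notin> \<Lambda>} = {x. circle_proj x \<in> \<Lambda>}" by auto
      ultimately show ?thesis by (metis closure_interior Compl_empty_eq double_complement)
    qed
    then have "circle_proj t \<in> circle_proj ` closure {x. circle_proj x \<in> \<Lambda>}" by simp
    also have "\<dots> \<subseteq> closure (circle_proj ` {x. circle_proj x \<in> \<Lambda>})"
      by (intro image_closure_subset[OF _ closed_closure] closure_subset)
        (intro continuous_on_circle_proj continuous_on_id)
    also have "\<dots> \<subseteq> closure \<Lambda>" by (intro closure_mono) auto
    finally show ?thesis using t by simp
  qed
  moreover have "\<Lambda> \<subseteq> S1" by (auto simp: \<Lambda>_def)
  ultimately show "top_of_set S1 closure_of \<Lambda> = S1"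
    by (auto simp: closure_of_subtopology Int_absorb1)
qed

section \<open>Horseshoes\<close>

lemma card_integer_translates_between:
  fixes x y a e :: real
  defines "J \<equiv> {j::int. x < a + j \<and> e + j < y}"
  shows "finite J" "real (card J) \<ge> y - x - (e - a) - 1"
proof -
  have J: "J = {\<lfloor>x - a\<rfloor> + 1..\<lceil>y - e\<rceil> - 1}"
  proof (intro equalityI subsetI)
    fix j assume "j \<in> J"
    then have "x - a < j" "j < y - e" by (auto simp: J_def)
    then have "\<lfloor>x - a\<rfloor> < j" "j < \<lceil>y - e\<rceil>" by (simp_all add: floor_less_iff less_ceiling_iff)
    then show "j \<in> {\<lfloor>x - a\<rfloor> + 1..\<lceil>y - e\<rceil> - 1}" by auto
  next
    fix j assume "j \<in> {\<lfloor>x - a\<rfloor> + 1..\<lceil>y - e\<rceil> - 1}"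
    then have "\<lfloor>x - a\<rfloor> < j" "j < \<lceil>y - e\<rceil>" by auto
    then show "j \<in> J" by (auto simp: J_def floor_less_iff less_ceiling_iff)
  qed
  then show "finite J" by simp
  have "real (card J) \<ge> real_of_int (\<lceil>y - e\<rceil> - 1 - \<lfloor>x - a\<rfloor>)" by (simp add: J)
  then show "real (card J) \<ge> y - x - (e - a) - 1"
    using le_of_int_ceiling[of "y - e"] of_int_floor_le[of "x - a"] by linarith
qed

text \<open>
  The pieces \<open>[l i, r i]\<close> are required to map exactly onto translates of the base \<open>[a, e]\<close>, endpoints to
  endpoints, so that pieces can be pulled back into each other repeatedly. The base is shorter than a
  period, so disjointness persists on the circle.
\<close>

locale horseshoe = doubling_semiconjugacy +
  fixes n :: nat and a e :: real and I :: "'i set" and l r :: "'i \<Rightarrow> real" and j :: "'i \<Rightarrow> int"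
  assumes base: "a < e" "e < a + 1"
    and finite_I: "finite I"
    and piece_subset: "i \<in> I \<Longrightarrow> {l i..r i} \<subseteq> {a..e}"
    and piece_less: "i \<in> I \<Longrightarrow> l i < r i"
    and piece_image: "i \<in> I \<Longrightarrow> (G ^^ n) ` {l i..r i} = {a + j i..e + j i}"
    and piece_ends: "i \<in> I \<Longrightarrow> {(G ^^ n) (l i), (G ^^ n) (r i)} = {a + j i, e + j i}"
    and piece_disjoint: "i \<in> I \<Longrightarrow> i' \<in> I \<Longrightarrow> i \<noteq> i' \<Longrightarrow> {l i..r i} \<inter> {l i'..r i'} = {}"
begin

abbreviation f where "f \<equiv> G ^^ n"

text \<open>
  All points of a tracking interval visit the pieces in the order prescribed by the word. Controlling
  the endpoints as well determines the increment of \<^term>\<open>A\<close> over the interval.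
\<close>

primrec tracks :: "'i list \<Rightarrow> real \<Rightarrow> real \<Rightarrow> bool" where
  "tracks [] u v \<longleftrightarrow> u = a \<and> v = e"
| "tracks (i # w) u v \<longleftrightarrow> u < v \<and> {u..v} \<subseteq> {l i..r i} \<and>
     (\<exists>u' v'. tracks w u' v' \<and> f ` {u..v} = {u' + j i..v' + j i} \<and> {f u, f v} = {u' + j i, v' + j i})"

lemma tracks_exists:
  assumes "set w \<subseteq> I"
  shows "\<exists>u v. tracks w u v \<and> a \<le> u \<and> u < v \<and> v \<le> e"
  using assms
proof (induction w)
  case Nil
  then show ?case using base by auto
next
  case (Cons i w)
  then obtain u' v' where uv': "tracks w u' v'" "a \<le> u'" "u' < v'" "v' \<le> e" by auto
  have i: "i \<in> I" using Cons.prems by simp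
  have ends: "f (l i) \<le> u' + j i \<and> v' + j i \<le> f (r i) \<or> f (r i) \<le> u' + j i \<and> v' + j i \<le> f (l i)"
    using piece_ends[OF i] uv' by (auto simp: doubleton_eq_iff)
  have less: "u' + j i < v' + j i" using uv'(3) by simp
  obtain u v where uv: "l i \<le> u" "u < v" "v \<le> r i" "f ` {u..v} = {u' + j i..v' + j i}"
      "{f u, f v} = {u' + j i, v' + j i}"
    by (rule exact_subinterval[OF continuous_funpow_G less_imp_le[OF piece_less[OF i]] less ends])
  then have "tracks (i # w) u v" using uv'(1) by auto
  moreover have "a \<le> l i" "r i \<le> e"
    using piece_subset[OF i] piece_less[OF i] by auto
  ultimately have "tracks (i # w) u v \<and> a \<le> u \<and> u < v \<and> v \<le> e"
    using uv by (intro conjI) (assumption | linarith)+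
  then show ?case by blast
qed

lemma tracks_disjoint:
  assumes "length w = length w'" "w \<noteq> w'" "set w \<subseteq> I" "set w' \<subseteq> I" "tracks w u v" "tracks w' s t"
  shows "{u..v} \<inter> {s..t} = {}"
  using assms
proof (induction w w' arbitrary: u v s t rule: list_induct2)
  case (Cons i w i' w')
  from Cons.prems obtain u' v' s' t' where
    uv: "{u..v} \<subseteq> {l i..r i}" "tracks w u' v'" "f ` {u..v} = {u' + j i..v' + j i}" and
    st: "{s..t} \<subseteq> {l i'..r i'}" "tracks w' s' t'" "f ` {s..t} = {s' + j i'..t' + j i'}" by auto
  show ?case
  proof (cases "i = i'")
    case True
    then have disj: "{u'..v'} \<inter> {s'..t'} = {}"
      using Cons uv(2) st(2) by auto
    show ?thesis
    proof (rule ccontr)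
      assume "\<not> ?thesis"
      then obtain x where "x \<in> {u..v}" "x \<in> {s..t}" by blast
      then have "f x \<in> {u' + j i..v' + j i}" "f x \<in> {s' + j i'..t' + j i'}"
        using uv(3) st(3) by blast+
      then have "f x - j i \<in> {u'..v'} \<inter> {s'..t'}" using True by auto
      then show False using disj by blast
    qed
  next
    case False
    then show ?thesis using piece_disjoint[of i i'] Cons.prems uv(1) st(1) by fastforce
  qed
qed simp

lemma funpow_f_add_int: "(f ^^ m) (x + of_int k) = (f ^^ m) x + 2 ^ (n * m) * of_int k"
  unfolding funpow_mult by (rule funpow_G_add_int)

lemma tracks_visits:
  assumes "tracks w u v" "x \<in> {u..v}" "m < length w"
  shows "\<exists>k::int. (f ^^ m) x + k \<in> {l (w ! m)..r (w ! m)}"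
  using assms
proof (induction w arbitrary: u v x m)
  case (Cons i w)
  from Cons.prems(1) obtain u' v' where uv: "{u..v} \<subseteq> {l i..r i}" "tracks w u' v'"
    "f ` {u..v} = {u' + j i..v' + j i}" by auto
  show ?case
  proof (cases m)
    case 0
    then show ?thesis using uv(1) Cons.prems(2) by (intro exI[of _ 0]) auto
  next
    case (Suc m')
    have "f x \<in> {u' + j i..v' + j i}" using uv(3) Cons.prems(2) by blast
    then have "f x + of_int (- j i) \<in> {u'..v'}" by simp
    then obtain k :: int where k: "(f ^^ m') (f x + of_int (- j i)) + k \<in> {l (w ! m')..r (w ! m')}"
      using Cons.IH[OF uv(2)] Cons.prems(3) Suc by auto
    have "(f ^^ m') (f x + of_int (- j i)) + k = (f ^^ m) x + of_int (k - 2 ^ (n * m') * j i)"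
      unfolding funpow_f_add_int Suc funpow_Suc_right by simp
    with k show ?thesis by (simp only: Suc nth_Cons_Suc) blast
  qed
qed simp

text \<open>Each iteration of \<^term>\<open>f\<close> multiplies differences of \<^term>\<open>A\<close> by \<open>2 ^ n\<close>.\<close>

lemma tracks_increment:
  assumes "tracks w u v"
  shows "2 ^ (n * length w) * \<bar>A v - A u\<bar> = \<bar>A e - A a\<bar>"
  using assms
proof (induction w arbitrary: u v)
  case (Cons i w)
  then obtain u' v' where uv': "tracks w u' v'" "{f u, f v} = {u' + j i, v' + j i}" by auto
  have "2 ^ n * \<bar>A v - A u\<bar> = \<bar>A (f v) - A (f u)\<bar>"
    by (simp add: A_funpow_G right_diff_distrib[symmetric] abs_mult)
  also have "\<dots> = \<bar>A (v' + j i) - A (u' + j i)\<bar>"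
    using uv'(2) by (auto simp: doubleton_eq_iff)
  also have "\<dots> = \<bar>A v' - A u'\<bar>" by (simp add: A_add_int)
  finally have "2 ^ n * \<bar>A v - A u\<bar> = \<bar>A v' - A u'\<bar>" .
  moreover have "2 ^ (n * length (i # w)) * \<bar>A v - A u\<bar> = 2 ^ (n * length w) * (2 ^ n * \<bar>A v - A u\<bar>)"
    by (simp add: power_add mult_ac)
  ultimately show ?case using Cons.IH[OF uv'(1)] by simp
qed simp

end

text \<open>
  The images of \<open>[a, b]\<close> and \<open>[b, e]\<close> under \<open>G ^^ n\<close> have lengths at least \<open>2 ^ n\<close> times the respective
  increments of \<open>A\<close>, up to an error independent of \<open>n\<close>. They contain that many translates of the base,
  again up to a bounded error, and the increments add up to more than \<open>1\<close>.
\<close>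

lemma (in doubling_semiconjugacy) horseshoe_exists:
  assumes "0 \<le> a" "a < 1" "a < b" "b < a + 1" "A b < A a"
  obtains n e and I :: "(int + int) set" and l r j
  where "n > 0" "card I > 2 ^ n" "A e > A a" "horseshoe A G n a e I l r j"
proof -
  obtain C where C: "C > 0" "\<And>t. \<bar>A t - t\<bar> \<le> C" using A_near_identity by blast
  define h where "h = A a - A b"
  have "h > 0" using assms by (simp add: h_def)
  \<comment> \<open>On a full period the values of \<open>A\<close> first drop by \<open>h\<close> and then rise by \<open>1 + h\<close>. Stopping
      slightly earlier keeps the total above \<open>1\<close> and makes the translates of the base disjoint.\<close>
  have "(A \<longlongrightarrow> A (a + 1)) (at_left (a + 1))"
    using continuous_A by (simp add: continuous_on_def) (metis filterlim_at_split)
  moreover have "max (A a) (A a + 1 - h) < A (a + 1)" using \<open>h > 0\<close> by (simp add: A_add_one)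
  ultimately have "\<forall>\<^sub>F e in at_left (a + 1). max (A a) (A a + 1 - h) < A e" by (rule order_tendstoD)
  moreover have "\<forall>\<^sub>F e in at_left (a + 1). e \<in> {b<..<a + 1}" by (rule eventually_at_left_real) (rule assms)
  ultimately have "\<forall>\<^sub>F e in at_left (a + 1). max (A a) (A a + 1 - h) < A e \<and> e \<in> {b<..<a + 1}"
    by (rule eventually_conj)
  then obtain e where e: "max (A a) (A a + 1 - h) < A e" "e \<in> {b<..<a + 1}"
    using eventually_happens'[OF trivial_limit_at_left_real] by blast
  obtain n0 where n0: "(4 * C + 4) / h < 2 ^ n0" using real_arch_pow[of 2] by auto
  define n where "n = Suc n0"
  have "(4 * C + 4) / h < 2 ^ n" using n0 by (simp add: n_def) (smt (verit) zero_less_power)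
  then have n: "4 * C + 4 < 2 ^ n * h" using \<open>h > 0\<close> by (simp add: field_simps)
  let ?f = "G ^^ n"
  have f_low: "?f t \<le> 2 ^ n * A t + C" and f_high: "2 ^ n * A t - C \<le> ?f t" for t
    using C(2)[of "?f t"] A_funpow_G[of n t] by linarith+
  define J1 where "J1 = {j::int. 2 ^ n * A b + C < a + j \<and> e + j < 2 ^ n * A a - C}"
  define J2 where "J2 = {j::int. 2 ^ n * A b + C < a + j \<and> e + j < 2 ^ n * A e - C}"
  have "\<exists>u v. a \<le> u \<and> u < v \<and> v \<le> b \<and> ?f ` {u..v} = {a + j..e + j} \<and> {?f u, ?f v} = {a + j, e + j}"
    if "j \<in> J1" for j
  proof -
    have ends: "?f a \<le> a + j \<and> e + j \<le> ?f b \<or> ?f b \<le> a + j \<and> e + j \<le> ?f a"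
      using that f_low[of b] f_high[of a] by (auto simp: J1_def)
    have "a \<le> b" "a + j < e + j" using assms e by auto
    from exact_subinterval[OF continuous_funpow_G this ends] show ?thesis by metis
  qed
  then obtain l1 r1 where piece1: "\<And>j. j \<in> J1 \<Longrightarrow> a \<le> l1 j \<and> l1 j < r1 j \<and> r1 j \<le> b \<and>
      ?f ` {l1 j..r1 j} = {a + j..e + j} \<and> {?f (l1 j), ?f (r1 j)} = {a + j, e + j}" by metis
  have "\<exists>u v. b \<le> u \<and> u < v \<and> v \<le> e \<and> ?f ` {u..v} = {a + j..e + j} \<and> {?f u, ?f v} = {a + j, e + j}"
    if "j \<in> J2" for j
  proof -
    have ends: "?f b \<le> a + j \<and> e + j \<le> ?f e \<or> ?f e \<le> a + j \<and> e + j \<le> ?f b"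
      using that f_low[of b] f_high[of e] by (auto simp: J2_def)
    have "b \<le> e" "a + j < e + j" using assms e by auto
    from exact_subinterval[OF continuous_funpow_G this ends] show ?thesis by metis
  qed
  then obtain l2 r2 where piece2: "\<And>j. j \<in> J2 \<Longrightarrow> b \<le> l2 j \<and> l2 j < r2 j \<and> r2 j \<le> e \<and>
      ?f ` {l2 j..r2 j} = {a + j..e + j} \<and> {?f (l2 j), ?f (r2 j)} = {a + j, e + j}" by metis
  define I where "I = J1 <+> J2"
  define l where "l = case_sum l1 l2"
  define r where "r = case_sum r1 r2"
  define j :: "int + int \<Rightarrow> int" where "j = case_sum id id"
  have fin: "finite J1" "finite J2"
    unfolding J1_def J2_def by (rule card_integer_translates_between)+
  have "e - a < 1" using e by simp
  then have "real (card J1) \<ge> 2 ^ n * (A a - A b) - 2 * C - 2" "real (card J2) \<ge> 2 ^ n * (A e - A b) - 2 * C - 2"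
    using card_integer_translates_between(2)[where a = a and e = e and x = "2 ^ n * A b + C" and y = "2 ^ n * A a - C"]
      card_integer_translates_between(2)[where a = a and e = e and x = "2 ^ n * A b + C" and y = "2 ^ n * A e - C"]
    unfolding J1_def[symmetric] J2_def[symmetric] right_diff_distrib by linarith+
  then have "real (card I) \<ge> 2 ^ n * (A a - A b) + 2 ^ n * (A e - A b) - 4 * C - 4"
    using fin by (simp add: I_def card_Plus)
  moreover have "2 ^ n * (A e - A b) \<ge> 2 ^ n * 1" using e by (intro mult_left_mono) (auto simp: h_def)
  ultimately have "real (card I) > 2 ^ n" using n unfolding h_def by linarith
  then have "card I > 2 ^ n" by (metis of_nat_less_iff of_nat_numeral of_nat_power)
  moreover have "horseshoe A G n a e I l r j"
  proof unfold_locales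
    show "a < e" "e < a + 1" using e assms by auto
    show "finite I" using fin by (simp add: I_def)
    fix i assume "i \<in> I"
    then consider k where "i = Inl k" "k \<in> J1" | k where "i = Inr k" "k \<in> J2" by (auto simp: I_def)
    note cases = this
    show "{l i..r i} \<subseteq> {a..e}" "l i < r i" "?f ` {l i..r i} = {a + j i..e + j i}"
        "{?f (l i), ?f (r i)} = {a + j i, e + j i}"
      using cases assms e
      by (cases; use piece1 piece2 in \<open>force simp: l_def r_def j_def\<close>)+
    fix i' assume "i' \<in> I" "i \<noteq> i'"
    have same: "{s..t} \<inter> {s'..t'} = {}"
      if "?f ` {s..t} = {a + k..e + k}" "?f ` {s'..t'} = {a + k'..e + k'}" "k \<noteq> k'" for s t s' t' and k k' :: int
    proof (rule ccontr)
      assume "\<not> ?thesis"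
      then obtain x where "x \<in> {s..t}" "x \<in> {s'..t'}" by blast
      then have "?f x \<in> {a + k..e + k}" "?f x \<in> {a + k'..e + k'}" using that by blast+
      then have "\<bar>real_of_int (k - k')\<bar> < 1" using e by auto
      then show False using \<open>k \<noteq> k'\<close> by linarith
    qed
    \<comment> \<open>Pieces on different sides could only meet at \<open>b\<close>, but \<open>?f b\<close> lies below all translates used.\<close>
    have different: "{l1 k..r1 k} \<inter> {l2 k'..r2 k'} = {}" if "k \<in> J1" "k' \<in> J2" for k k'
    proof (rule ccontr)
      assume "\<not> ?thesis"
      then have "b \<in> {l1 k..r1 k}" using piece1[OF that(1)] piece2[OF that(2)] by force
      then have "?f b \<in> {a + k..e + k}" using piece1[OF that(1)] by blast
      then show False using f_low[of b] that(1) by (auto simp: J1_def)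
    qed
    show "{l i..r i} \<inter> {l i'..r i'} = {}"
      using cases
    proof cases
      case (1 k)
      show ?thesis
      proof (cases i')
        case (Inl k')
        then have "k' \<in> J1" "k \<noteq> k'" using \<open>i' \<in> I\<close> \<open>i \<noteq> i'\<close> 1 by (auto simp: I_def)
        then show ?thesis using same[of "l1 k" "r1 k" k "l1 k'" "r1 k'" k'] piece1 1 Inl by (simp add: l_def r_def)
      next
        case (Inr k')
        then have "k' \<in> J2" using \<open>i' \<in> I\<close> by (auto simp: I_def)
        then show ?thesis using different[of k k'] 1 Inr by (simp add: l_def r_def)
      qed
    next
      case (2 k)
      show ?thesis
      proof (cases i')
        case (Inl k')
        then have "k' \<in> J1" using \<open>i' \<in> I\<close> by (auto simp: I_def)
        then show ?thesis using different[of k' k] 2 Inl by (simp add: l_def r_def Int_commute)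
      next
        case (Inr k')
        then have "k' \<in> J2" "k \<noteq> k'" using \<open>i' \<in> I\<close> \<open>i \<noteq> i'\<close> 2 by (auto simp: I_def)
        then show ?thesis using same[of "l2 k" "r2 k" k "l2 k'" "r2 k'" k'] piece2 2 Inr by (simp add: l_def r_def)
      qed
    qed
  qed
  moreover have "n > 0" "A e > A a" using e by (auto simp: n_def)
  ultimately show ?thesis using that by blast
qed

section \<open>Variation\<close>

text \<open>The endpoints of disjoint intervals, sorted, form a partition in which each interval is a single step.\<close>

lemma sum_disjoint_increments_le:
  fixes F :: "real \<Rightarrow> real"
  assumes B: "\<And>n t. mono_on {..n} t \<Longrightarrow> t ` {..n} \<subseteq> {c..d} \<Longrightarrow> (\<Sum>i<n. \<bar>F (t (Suc i)) - F (t i)\<bar>) \<le> B"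
    and W: "finite W" "W \<noteq> {}" "\<And>w. w \<in> W \<Longrightarrow> c \<le> u w \<and> u w < v w \<and> v w \<le> d"
    and disj: "\<And>w w'. w \<in> W \<Longrightarrow> w' \<in> W \<Longrightarrow> w \<noteq> w' \<Longrightarrow> {u w..v w} \<inter> {u w'..v w'} = {}"
  shows "(\<Sum>w\<in>W. \<bar>F (v w) - F (u w)\<bar>) \<le> B"
proof -
  define P where "P = u ` W \<union> v ` W"
  define xs where "xs = sorted_list_of_set P"
  have "finite P" "P \<noteq> {}" using W by (auto simp: P_def)
  then have set_xs: "set xs = P" by (simp add: xs_def)
  then have "xs \<noteq> []" using \<open>P \<noteq> {}\<close> by auto
  have mono_xs: "xs ! i \<le> xs ! k" if "i \<le> k" "k < length xs" for i k
    using that by (simp add: xs_def sorted_nth_mono)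
  have strict_xs: "xs ! i < xs ! k" if "i < k" "k < length xs" for i k
    using that sorted_wrt_nth_less[of "(<)" xs] by (simp add: xs_def)
  define n where "n = length xs - 1"
  have len: "length xs = Suc n" using \<open>xs \<noteq> []\<close> by (simp add: n_def)
  have "\<exists>i<n. xs ! i = u w \<and> xs ! Suc i = v w" if w: "w \<in> W" for w
  proof -
    obtain i where i: "i < length xs" "xs ! i = u w" using w set_xs by (metis P_def UnI1 image_eqI in_set_conv_nth)
    obtain k where k: "k < length xs" "xs ! k = v w" using w set_xs by (metis P_def UnI2 image_eqI in_set_conv_nth)
    have "i < k" using mono_xs[of k i] i k W(3)[OF w] by (metis not_le)
    moreover have "\<not> Suc i < k"
    proof
      assume "Suc i < k"
      then have between: "u w < xs ! Suc i" "xs ! Suc i < v w" using strict_xs[of i "Suc i"] strict_xs[of "Suc i" k] i k by auto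
      have "xs ! Suc i \<in> P" using \<open>Suc i < k\<close> k set_xs by (metis nth_mem order.strict_trans)
      then obtain w' where w': "w' \<in> W" "xs ! Suc i = u w' \<or> xs ! Suc i = v w'" by (auto simp: P_def)
      then have "xs ! Suc i \<in> {u w'..v w'}" using W(3)[of w'] by auto
      moreover have "xs ! Suc i \<in> {u w..v w}" using between by auto
      ultimately have "w' = w" using disj[OF w'(1) w] by blast
      then show False using w' between by auto
    qed
    ultimately have "k = Suc i" by simp
    then show ?thesis using i k len by auto
  qed
  then obtain idx where idx: "\<And>w. w \<in> W \<Longrightarrow> idx w < n" "\<And>w. w \<in> W \<Longrightarrow> xs ! idx w = u w"
    "\<And>w. w \<in> W \<Longrightarrow> xs ! Suc (idx w) = v w" by metis
  have "inj_on idx W"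
  proof (rule inj_onI)
    fix w w' assume w: "w \<in> W" "w' \<in> W" "idx w = idx w'"
    then have "u w = u w'" using idx(2) by metis
    then have "u w \<in> {u w..v w} \<inter> {u w'..v w'}" using W(3)[OF w(1)] W(3)[OF w(2)] by auto
    then show "w = w'" using disj[OF w(1,2)] by blast
  qed
  have "(\<Sum>w\<in>W. \<bar>F (v w) - F (u w)\<bar>) = (\<Sum>w\<in>W. \<bar>F (xs ! Suc (idx w)) - F (xs ! idx w)\<bar>)"
    by (intro sum.cong) (simp_all add: idx)
  also have "\<dots> = (\<Sum>i\<in>idx ` W. \<bar>F (xs ! Suc i) - F (xs ! i)\<bar>)"
    by (simp add: sum.reindex[OF \<open>inj_on idx W\<close>])
  also have "\<dots> \<le> (\<Sum>i<n. \<bar>F (xs ! Suc i) - F (xs ! i)\<bar>)"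
    by (intro sum_mono2) (use idx in auto)
  also have "\<dots> \<le> B"
  proof (rule B)
    show "mono_on {..n} (\<lambda>i. xs ! i)" by (intro mono_onI) (simp add: mono_xs len)
    have "xs ! i \<in> P" if "i \<le> n" for i using that len set_xs by (metis le_imp_less_Suc nth_mem)
    moreover have "P \<subseteq> {c..d}" using W(3) by (force simp: P_def)
    ultimately show "(\<lambda>i. xs ! i) ` {..n} \<subseteq> {c..d}" by auto
  qed
  finally show ?thesis .
qed

text \<open>A monotone sequence in two periods is the sum of its truncations to either period.\<close>

lemma variation_two_periods:
  fixes F :: "real \<Rightarrow> real"
  assumes F: "\<And>t. F (t + 1) = F t + 1"
    and B: "\<And>n t. mono_on {..n} t \<Longrightarrow> t ` {..n} \<subseteq> {0..1} \<Longrightarrow> (\<Sum>i<n. \<bar>F (t (Suc i)) - F (t i)\<bar>) \<le> B"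
    and t: "mono_on {..n} t" "t ` {..n} \<subseteq> {0..2}"
  shows "(\<Sum>i<n. \<bar>F (t (Suc i)) - F (t i)\<bar>) \<le> 2 * B"
proof -
  define s where "s i = min (t i) 1" for i
  define r where "r i = max (t i) 1 - 1" for i
  have "F (t i) = F (s i) + F (r i) + 1 - F 1" for i
    using F[of 0] F[of "t i - 1"] by (simp add: s_def r_def min_def max_def)
  then have "(\<Sum>i<n. \<bar>F (t (Suc i)) - F (t i)\<bar>) \<le> (\<Sum>i<n. \<bar>F (s (Suc i)) - F (s i)\<bar> + \<bar>F (r (Suc i)) - F (r i)\<bar>)"
    by (intro sum_mono) (simp add: abs_if)
  also have "\<dots> = (\<Sum>i<n. \<bar>F (s (Suc i)) - F (s i)\<bar>) + (\<Sum>i<n. \<bar>F (r (Suc i)) - F (r i)\<bar>)"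
    by (rule sum.distrib)
  also have "\<dots> \<le> B + B"
  proof (intro add_mono B)
    show "mono_on {..n} s" "mono_on {..n} r"
      using monotone_onD[OF t(1)] unfolding s_def r_def
      by (intro mono_onI min.mono max.mono diff_right_mono; simp)+
    show "s ` {..n} \<subseteq> {0..1}" "r ` {..n} \<subseteq> {0..1}"
      using t(2) by (auto simp: s_def r_def image_subset_iff)
  qed
  finally show ?thesis by simp
qed

context doubling_semiconjugacy
begin

lemma bounded_variation_if_mono:
  assumes "mono A"
  shows "bounded_variation_on 0 1 A"
  unfolding bounded_variation_on_def
proof (intro exI[of _ 1] allI impI, elim conjE)
  fix n and t :: "nat \<Rightarrow> real"
  assume t: "mono_on {..n} t" "t ` {..n} \<subseteq> {0..1}"
  have "\<bar>A (t (Suc i)) - A (t i)\<bar> = A (t (Suc i)) - A (t i)" if "i < n" for i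
    using monoD[OF assms] monotone_onD[OF t(1), of i "Suc i"] that by simp
  then have "(\<Sum>i<n. \<bar>A (t (Suc i)) - A (t i)\<bar>) = (\<Sum>i<n. A (t (Suc i)) - A (t i))" by simp
  also have "\<dots> = A (t n) - A (t 0)" by (rule sum_lessThan_telescope)
  also have "\<dots> \<le> A 1 - A 0"
  proof (intro diff_mono monoD[OF assms])
    have "t n \<in> {0..1}" "t 0 \<in> {0..1}" using t(2) by auto
    then show "t n \<le> 1" "0 \<le> t 0" by auto
  qed
  also have "\<dots> = 1" using A_add_one[of 0] by simp
  finally show "(\<Sum>i<n. \<bar>A (t (Suc i)) - A (t i)\<bar>) \<le> 1" .
qed

text \<open>
  The \<open>N ^ k\<close> intervals belonging to the words of length \<open>k\<close> contribute \<open>(N / 2 ^ n) ^ k\<close> times a positive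
  constant to the variation, and \<open>N > 2 ^ n\<close>.
\<close>

lemma not_bounded_variation_if_not_mono:
  assumes "\<not> mono A"
  shows "\<not> bounded_variation_on 0 1 A"
proof
  assume "bounded_variation_on 0 1 A"
  then obtain B where B: "\<And>n t. mono_on {..n} t \<Longrightarrow> t ` {..n} \<subseteq> {0..1} \<Longrightarrow> (\<Sum>i<n. \<bar>A (t (Suc i)) - A (t i)\<bar>) \<le> B"
    unfolding bounded_variation_on_def by blast
  obtain a b where ab: "0 \<le> a" "a < 1" "a < b" "b < a + 1" "A b < A a"
    using fold_within_period[OF assms] by blast
  obtain n e and I :: "(int + int) set" and l r j
    where n: "n > 0" "card I > 2 ^ n" "A e > A a" and "horseshoe A G n a e I l r j"
    by (rule horseshoe_exists[OF ab])
  then interpret horseshoe A G n a e I l r j by blast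
  have bound: "(card I / 2 ^ n) ^ k * \<bar>A e - A a\<bar> \<le> 2 * B" for k
  proof -
    define W where "W = {w. set w \<subseteq> I \<and> length w = k}"
    have W: "finite W" "card W = card I ^ k"
      unfolding W_def using finite_I by (simp_all add: finite_lists_length_eq card_lists_length_eq)
    then have "W \<noteq> {}" using n(2) by auto
    obtain u v where uv: "\<And>w. w \<in> W \<Longrightarrow> tracks w (u w) (v w) \<and> a \<le> u w \<and> u w < v w \<and> v w \<le> e"
      using tracks_exists unfolding W_def mem_Collect_eq by metis
    have "(card I / 2 ^ n) ^ k * \<bar>A e - A a\<bar> = (\<Sum>w\<in>W. \<bar>A e - A a\<bar> / 2 ^ (n * k))"
      by (simp add: W power_divide power_mult)
    also have "\<dots> = (\<Sum>w\<in>W. \<bar>A (v w) - A (u w)\<bar>)"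
    proof (rule sum.cong)
      fix w assume "w \<in> W"
      then have "2 ^ (n * k) * \<bar>A (v w) - A (u w)\<bar> = \<bar>A e - A a\<bar>"
        using tracks_increment uv by (auto simp: W_def)
      then show "\<bar>A e - A a\<bar> / 2 ^ (n * k) = \<bar>A (v w) - A (u w)\<bar>" by (simp add: field_simps)
    qed simp
    also have "\<dots> \<le> 2 * B"
    proof (rule sum_disjoint_increments_le[where F = A and u = u and v = v and c = 0 and d = 2])
      show "(\<Sum>i<n. \<bar>A (t (Suc i)) - A (t i)\<bar>) \<le> 2 * B" if "mono_on {..n} t" "t ` {..n} \<subseteq> {0..2}" for n t
        by (rule variation_two_periods[of A, OF A_add_one B that])
      show "0 \<le> u w \<and> u w < v w \<and> v w \<le> 2" if "w \<in> W" for w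
        using uv[OF that] ab base by auto
      show "{u w..v w} \<inter> {u w'..v w'} = {}" if "w \<in> W" "w' \<in> W" "w \<noteq> w'" for w w'
        using tracks_disjoint[of w w'] uv that by (auto simp: W_def simp del: Int_atLeastAtMost)
    qed (use W \<open>W \<noteq> {}\<close> in auto)
    finally show ?thesis .
  qed
  have "real (2 ^ n) < real (card I)" using n(2) by (simp only: of_nat_less_iff)
  then have "card I / 2 ^ n > 1" by simp
  then obtain k where "2 * B / \<bar>A e - A a\<bar> < (card I / 2 ^ n) ^ k" using real_arch_pow by blast
  then show False using bound[of k] n(3) by (simp add: field_simps)
qed

end

section \<open>Entropy\<close>

text \<open>The limit superior may be estimated along the multiples of \<open>n\<close>.\<close>

lemma topological_entropy_ge:
  fixes X :: "'a::metric_space set"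
  assumes "n > 0" "N > 0" "\<epsilon> > 0"
    and E: "\<And>k. \<exists>E. finite E \<and> card E = N ^ k \<and> separated X T (n * k) \<epsilon> E"
  shows "ereal (ln N / n) \<le> topological_entropy X T"
proof -
  define s where "s m = (SUP E\<in>{E. finite E \<and> E \<noteq> {} \<and> separated X T m \<epsilon> E}. ereal (ln (real (card E)) / real m))" for m
  have "ereal (ln N / n) \<le> s (n * Suc k)" for k
  proof -
    obtain E where E: "finite E" "card E = N ^ Suc k" "separated X T (n * Suc k) \<epsilon> E"
      using assms(4) by blast
    then have "E \<noteq> {}" using \<open>N > 0\<close> by auto
    have "ln N / n = ln (real (card E)) / real (n * Suc k)"
      unfolding E(2) of_nat_power of_nat_mult using assms(1,2) by (subst ln_realpow) (simp_all del: power_Suc of_nat_Suc)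
    also have "ereal \<dots> \<le> s (n * Suc k)"
      unfolding s_def by (rule SUP_upper) (use E \<open>E \<noteq> {}\<close> in auto)
    finally show ?thesis .
  qed
  then have "ereal (ln N / n) \<le> limsup (s \<circ> (\<lambda>k. n * Suc k))"
    by (intro le_Limsup) auto
  also have "\<dots> \<le> limsup s"
    by (rule limsup_subseq_mono) (use \<open>n > 0\<close> in \<open>auto simp: strict_mono_def\<close>)
  also have "\<dots> \<le> topological_entropy X T"
    unfolding topological_entropy_def s_def by (rule SUP_upper) (use \<open>\<epsilon> > 0\<close> in auto)
  finally show ?thesis .
qed

lemma topological_entropy_le:
  fixes X :: "'a::metric_space set"
  assumes "c > 0"
    and bound: "\<And>\<epsilon>. \<epsilon> > 0 \<Longrightarrow> \<exists>C>0. \<forall>n E. finite E \<longrightarrow> separated X T n \<epsilon> E \<longrightarrow> real (card E) \<le> C * c ^ n"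
  shows "topological_entropy X T \<le> ereal (ln c)"
  unfolding topological_entropy_def
proof (rule SUP_least)
  fix \<epsilon> :: real assume "\<epsilon> \<in> {0<..}"
  then obtain C where C: "C > 0" "\<And>n E. finite E \<Longrightarrow> separated X T n \<epsilon> E \<Longrightarrow> real (card E) \<le> C * c ^ n"
    using bound[of \<epsilon>] by (metis greaterThan_iff)
  have "(SUP E\<in>{E. finite E \<and> E \<noteq> {} \<and> separated X T n \<epsilon> E}. ereal (ln (real (card E)) / real n)) \<le> ereal (ln C / n + ln c)"
    if "n > 0" for n
  proof (rule SUP_least)
    fix E assume "E \<in> {E. finite E \<and> E \<noteq> {} \<and> separated X T n \<epsilon> E}"
    then have "0 < real (card E)" "real (card E) \<le> C * c ^ n" using C(2) by (auto simp: card_gt_0_iff)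
    then have "ln (real (card E)) \<le> ln (C * c ^ n)" by simp
    also have "\<dots> = ln C + n * ln c" using C \<open>c > 0\<close> by (simp add: ln_mult ln_realpow)
    finally show "ereal (ln (real (card E)) / real n) \<le> ereal (ln C / n + ln c)"
      using that by (simp add: field_simps)
  qed
  then have "limsup (\<lambda>n. SUP E\<in>{E. finite E \<and> E \<noteq> {} \<and> separated X T n \<epsilon> E}. ereal (ln (real (card E)) / real n))
      \<le> limsup (\<lambda>n. ereal (ln C / n + ln c))"
    by (intro Limsup_mono) (auto intro: eventually_mono[OF eventually_gt_at_top[of 0]])
  also have "(\<lambda>n. ereal (ln C / n + ln c)) \<longlonglongrightarrow> ereal (0 + ln c)"
    by (intro tendsto_intros lim_const_over_n)
  then have "limsup (\<lambda>n. ereal (ln C / n + ln c)) = ereal (ln c)"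
    by (simp add: lim_imp_Limsup)
  finally show "limsup (\<lambda>n. SUP E\<in>{E. finite E \<and> E \<noteq> {} \<and> separated X T n \<epsilon> E}. ereal (ln (real (card E)) / real n)) \<le> ereal (ln c)" .
qed

lemma circle_lift_funpow:
  assumes "circle_lift g G"
  shows "(g ^^ i) (circle_proj x) = circle_proj ((G ^^ i) x)"
  using assms by (induction i) (auto simp: circle_lift_def)

context horseshoe
begin

text \<open>
  The projection is injective on the base, so the pieces project to finitely many disjoint compact
  sets, which have positive distance from each other.
\<close>

lemma pieces_separated:
  obtains \<epsilon> where "\<epsilon> > 0" "\<And>i i' s t. i \<in> I \<Longrightarrow> i' \<in> I \<Longrightarrow> i \<noteq> i' \<Longrightarrow> s \<in> {l i..r i} \<Longrightarrow> t \<in> {l i'..r i'} \<Longrightarrow>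
    dist (circle_proj s) (circle_proj t) > \<epsilon>"
proof -
  have "\<exists>\<delta>>0. \<forall>s\<in>{l i..r i}. \<forall>t\<in>{l i'..r i'}. \<delta> \<le> dist (circle_proj s) (circle_proj t)"
    if "i \<in> I" "i' \<in> I" "i \<noteq> i'" for i i'
  proof -
    have "circle_proj s \<noteq> circle_proj t" if st: "s \<in> {l i..r i}" "t \<in> {l i'..r i'}" for s t
    proof
      assume "circle_proj s = circle_proj t"
      then obtain k :: int where k: "s = t + of_int k" by (auto simp: circle_proj_eq_iff)
      have "s \<in> {a..e}" "t \<in> {a..e}"
        using subsetD[OF piece_subset[OF \<open>i \<in> I\<close>] st(1)] subsetD[OF piece_subset[OF \<open>i' \<in> I\<close>] st(2)] .
      then have "\<bar>real_of_int k\<bar> < 1" using k base by auto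
      then have "s = t" using k by simp
      then show False using piece_disjoint[OF \<open>i \<in> I\<close> \<open>i' \<in> I\<close> \<open>i \<noteq> i'\<close>] st by blast
    qed
    then have "circle_proj ` {l i..r i} \<inter> circle_proj ` {l i'..r i'} = {}" by blast
    moreover have "compact (circle_proj ` {l i..r i})" for i
      by (intro compact_continuous_image continuous_on_circle_proj continuous_on_id compact_Icc)
    ultimately show ?thesis
      using separate_compact_closed[of "circle_proj ` {l i..r i}" "circle_proj ` {l i'..r i'}"]
      by (simp add: compact_imp_closed)
  qed
  then obtain \<delta> where \<delta>: "\<And>i i'. i \<in> I \<Longrightarrow> i' \<in> I \<Longrightarrow> i \<noteq> i' \<Longrightarrow> \<delta> i i' > 0 \<and>
      (\<forall>s\<in>{l i..r i}. \<forall>t\<in>{l i'..r i'}. \<delta> i i' \<le> dist (circle_proj s) (circle_proj t))" by metis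
  define D where "D = insert 1 ((\<lambda>(i, i'). \<delta> i i') ` {(i, i'). i \<in> I \<and> i' \<in> I \<and> i \<noteq> i'})"
  have "finite {(i, i'). i \<in> I \<and> i' \<in> I \<and> i \<noteq> i'}"
    by (rule finite_subset[of _ "I \<times> I"]) (use finite_I in auto)
  then have D: "finite D" "D \<noteq> {}" by (auto simp: D_def)
  have "Min D > 0" using D \<delta> by (auto simp: D_def)
  have Min_le_\<delta>: "Min D \<le> \<delta> i i'" if "i \<in> I" "i' \<in> I" "i \<noteq> i'" for i i'
    using D(1) that by (intro Min_le) (auto simp: D_def)
  have "Min D / 2 < dist (circle_proj s) (circle_proj t)"
    if "i \<in> I" "i' \<in> I" "i \<noteq> i'" "s \<in> {l i..r i}" "t \<in> {l i'..r i'}" for i i' s t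
  proof -
    have "\<delta> i i' \<le> dist (circle_proj s) (circle_proj t)" using \<delta>[of i i'] that by blast
    moreover have "Min D \<le> \<delta> i i'" by (rule Min_le_\<delta>[OF that(1-3)])
    ultimately show ?thesis using \<open>Min D > 0\<close> by linarith
  qed
  then show ?thesis using that[of "Min D / 2"] \<open>Min D > 0\<close> by simp
qed

text \<open>
  Choose one point for every word of length \<open>k\<close>. For two words with different letters at position \<open>m\<close>,
  the points lie in different pieces after \<open>m\<close> applications of \<open>G ^^ n\<close>.
\<close>

lemma topological_entropy_horseshoe:
  assumes "circle_lift g G" "n > 0" "card I > 0"
  shows "ereal (ln (card I) / n) \<le> topological_entropy S1 g"
proof -
  obtain \<epsilon> where \<epsilon>: "\<epsilon> > 0" "\<And>i i' s t. i \<in> I \<Longrightarrow> i' \<in> I \<Longrightarrow> i \<noteq> i' \<Longrightarrow> s \<in> {l i..r i} \<Longrightarrow> t \<in> {l i'..r i'} \<Longrightarrow>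
    dist (circle_proj s) (circle_proj t) > \<epsilon>" using pieces_separated by blast
  show ?thesis
  proof (rule topological_entropy_ge[OF assms(2,3) \<epsilon>(1)])
    fix k
    define W where "W = {w. set w \<subseteq> I \<and> length w = k}"
    have W: "finite W" "card W = card I ^ k"
      unfolding W_def using finite_I by (simp_all add: finite_lists_length_eq card_lists_length_eq)
    obtain u v where uv: "\<And>w. w \<in> W \<Longrightarrow> tracks w (u w) (v w) \<and> u w < v w"
      using tracks_exists unfolding W_def mem_Collect_eq by metis
    have sep: "\<exists>i<n * k. dist ((g ^^ i) (circle_proj (u w))) ((g ^^ i) (circle_proj (u w'))) > \<epsilon>"
      if w: "w \<in> W" "w' \<in> W" "w \<noteq> w'" for w w'
    proof -
      obtain m where m: "m < k" "w ! m \<noteq> w' ! m"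
        using w by (auto simp: W_def list_eq_iff_nth_eq)
      have mem: "u w \<in> {u w..v w}" "u w' \<in> {u w'..v w'}" using uv[OF w(1)] uv[OF w(2)] by auto
      have "length w = k" "length w' = k" using w by (auto simp: W_def)
      obtain p :: int where "(f ^^ m) (u w) + p \<in> {l (w ! m)..r (w ! m)}"
        using tracks_visits[OF conjunct1[OF uv[OF w(1)]]] mem(1) \<open>length w = k\<close> m(1) by metis
      moreover obtain q :: int where "(f ^^ m) (u w') + q \<in> {l (w' ! m)..r (w' ! m)}"
        using tracks_visits[OF conjunct1[OF uv[OF w(2)]]] mem(2) \<open>length w' = k\<close> m(1) by metis
      moreover have "w ! m \<in> I" "w' ! m \<in> I" using w m(1) by (auto simp: W_def)
      ultimately have "dist (circle_proj ((f ^^ m) (u w) + p)) (circle_proj ((f ^^ m) (u w') + q)) > \<epsilon>"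
        using \<epsilon>(2) m(2) by blast
      then have "dist ((g ^^ (n * m)) (circle_proj (u w))) ((g ^^ (n * m)) (circle_proj (u w'))) > \<epsilon>"
        by (simp add: circle_lift_funpow[OF assms(1)] funpow_mult)
      moreover have "n * m < n * k" using m(1) \<open>n > 0\<close> by simp
      ultimately show ?thesis by blast
    qed
    have "inj_on (\<lambda>w. circle_proj (u w)) W"
    proof (rule inj_onI, rule ccontr)
      fix w w' assume "w \<in> W" "w' \<in> W" "circle_proj (u w) = circle_proj (u w')" "w \<noteq> w'"
      then show False using sep[of w w'] \<epsilon>(1) by auto
    qed
    then have "card ((\<lambda>w. circle_proj (u w)) ` W) = card I ^ k" by (simp add: card_image W)
    moreover have "separated S1 g (n * k) \<epsilon> ((\<lambda>w. circle_proj (u w)) ` W)"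
      unfolding separated_def using sep by (auto simp del: funpow.simps)
    ultimately show "\<exists>E. finite E \<and> card E = card I ^ k \<and> separated S1 g (n * k) \<epsilon> E"
      using W(1) by blast
  qed
qed

end

lemma (in doubling_semiconjugacy) topological_entropy_gt_if_not_mono:
  assumes "circle_lift g G" "\<not> mono A"
  shows "topological_entropy S1 g > ereal (ln 2)"
proof -
  obtain a b where ab: "0 \<le> a" "a < 1" "a < b" "b < a + 1" "A b < A a"
    using fold_within_period[OF assms(2)] by blast
  obtain n e and I :: "(int + int) set" and l r j
    where n: "n > 0" "card I > 2 ^ n" "A e > A a" and "horseshoe A G n a e I l r j"
    by (rule horseshoe_exists[OF ab])
  then interpret horseshoe A G n a e I l r j by blast
  have "real (2 ^ n) < real (card I)" using n(2) by (simp only: of_nat_less_iff)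
  then have "ln (2 ^ n) < ln (real (card I))" by simp
  then have "ln 2 < ln (card I) / n" using n(1) by (simp add: ln_realpow field_simps)
  also have "ereal \<dots> \<le> topological_entropy S1 g"
    using n by (intro topological_entropy_horseshoe assms(1)) auto
  finally show ?thesis by simp
qed

text \<open>
  Doubling \<open>k\<close> times sends both points to \<open>1\<close>, and two points merge under doubling only if they are
  antipodal one step earlier.
\<close>

lemma dyadic_points_become_antipodal:
  fixes i i' :: int
  assumes "\<not> 2 ^ k dvd i - i'"
  shows "\<exists>m<k. circle_proj (2 ^ m * (i / 2 ^ k)) = - circle_proj (2 ^ m * (i' / 2 ^ k))"
  using assms
proof (induction k)
  case (Suc k)
  show ?case
  proof (cases "2 ^ k dvd i - i'")
    case False
    then obtain m where m: "m < k" "circle_proj (2 ^ m * (i / 2 ^ k)) = - circle_proj (2 ^ m * (i' / 2 ^ k))"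
      using Suc.IH by blast
    then show ?thesis by (intro exI[of _ "Suc m"]) (simp add: mult_ac)
  next
    case True
    then obtain c where c: "i - i' = 2 ^ k * c" by (auto elim: dvdE)
    have "odd c"
    proof
      assume "even c"
      then have "2 ^ Suc k dvd i - i'" unfolding c by (simp add: mult.commute mult_dvd_mono)
      then show False using Suc.prems by blast
    qed
    then obtain c' where c': "c = 2 * c' + 1" by (auto elim: oddE)
    have "real_of_int i = i' + 2 ^ k * c" using arg_cong[OF c, of real_of_int] by simp
    then have "i / 2 ^ Suc k = (i' / 2 ^ Suc k + 1 / 2) + of_int c'"
      by (simp add: c' field_simps)
    then have "circle_proj (i / 2 ^ Suc k) = circle_proj (i' / 2 ^ Suc k + 1 / 2)"
      by (simp only: circle_proj_add_int)
    also have "\<dots> = - circle_proj (i' / 2 ^ Suc k)"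
      by (simp add: circle_proj_def distrib_left cis_mult[symmetric])
    finally show ?thesis by (intro exI[of _ 0]) simp
  qed
qed simp

lemma dist_circle_proj_le: "dist (circle_proj s) (circle_proj t) \<le> 2 * pi * \<bar>s - t\<bar>"
proof -
  have "circle_proj s - circle_proj t = circle_proj t * (exp (\<i> * of_real (2 * pi * (s - t))) - 1)"
    unfolding circle_proj_def cis_conv_exp[symmetric] right_diff_distrib cis_mult by (simp add: algebra_simps)
  then have "dist (circle_proj s) (circle_proj t) = 2 * \<bar>sin (2 * pi * (s - t) / 2)\<bar>"
    by (simp only: dist_norm norm_mult norm_circle_proj dist_exp_i_1 mult_1)
  also have "\<dots> \<le> 2 * \<bar>2 * pi * (s - t) / 2\<bar>" by (intro mult_left_mono abs_sin_x_le_abs_x) simp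
  also have "\<dots> = 2 * pi * \<bar>s - t\<bar>" by (simp add: abs_mult)
  finally show ?thesis .
qed

text \<open>
  Points of the same arc of length \<open>1 / (2 ^ n * P)\<close> stay within \<open>2 * pi / P\<close> of each other for \<open>n\<close>
  steps, so a separated set has at most one point in each of the \<open>2 ^ n * P\<close> arcs.
\<close>

lemma card_separated_doubling_le:
  assumes "finite E" "separated S1 doubling n \<epsilon> E" "P > 0" "2 * pi / real P \<le> \<epsilon>"
  shows "card E \<le> 2 ^ n * P"
proof -
  define T where "T z = (SOME t. z = circle_proj t \<and> 0 \<le> t \<and> t < 1)" for z
  have T: "z = circle_proj (T z) \<and> 0 \<le> T z \<and> T z < 1" if z: "z \<in> S1" for z
  proof -
    obtain t where "z = circle_proj t" "0 \<le> t" "t < 1" by (rule S1_cases[OF z])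
    then have "\<exists>t. z = circle_proj t \<and> 0 \<le> t \<and> t < 1" by blast
    then show ?thesis unfolding T_def by (rule someI_ex)
  qed
  define M where "M = 2 ^ n * real P"
  have "M > 0" using assms(3) by (simp add: M_def)
  have "E \<subseteq> S1" using assms(2) by (simp add: separated_def)
  have "inj_on (\<lambda>z. \<lfloor>M * T z\<rfloor>) E"
  proof (rule inj_onI, rule ccontr)
    fix z z' assume z: "z \<in> E" "z' \<in> E" "\<lfloor>M * T z\<rfloor> = \<lfloor>M * T z'\<rfloor>" "z \<noteq> z'"
    then obtain i where i: "i < n" "dist ((doubling ^^ i) z) ((doubling ^^ i) z') > \<epsilon>"
      using assms(2) unfolding separated_def by blast
    have "\<bar>M * T z - M * T z'\<bar> < 1"
      using z(3) floor_correct[of "M * T z"] floor_correct[of "M * T z'"] by linarith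
    then have "M * \<bar>T z - T z'\<bar> < 1" using \<open>M > 0\<close> by (simp add: right_diff_distrib[symmetric] abs_mult)
    then have close: "2 ^ n * \<bar>T z - T z'\<bar> < 1 / P" using assms(3) by (simp add: M_def field_simps)
    have "dist ((doubling ^^ i) z) ((doubling ^^ i) z')
        = dist (circle_proj (2 ^ i * T z)) (circle_proj (2 ^ i * T z'))"
      using T z \<open>E \<subseteq> S1\<close> by (metis doubling_funpow_circle_proj subsetD)
    also have "\<dots> \<le> 2 * pi * (2 ^ i * \<bar>T z - T z'\<bar>)"
      using dist_circle_proj_le[of "2 ^ i * T z" "2 ^ i * T z'"]
      by (simp add: right_diff_distrib[symmetric] abs_mult)
    also have "\<dots> \<le> 2 * pi * (2 ^ n * \<bar>T z - T z'\<bar>)"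
      using i(1) by (intro mult_left_mono mult_right_mono power_increasing) auto
    also have "\<dots> \<le> 2 * pi * (1 / P)" using close by (intro mult_left_mono) auto
    also have "\<dots> \<le> \<epsilon>" using assms(4) by simp
    finally show False using i(2) by simp
  qed
  moreover have "(\<lambda>z. \<lfloor>M * T z\<rfloor>) ` E \<subseteq> {0..<2 ^ n * int P}"
  proof (rule image_subsetI)
    fix z assume "z \<in> E"
    then have "0 \<le> T z" "T z < 1" using T \<open>E \<subseteq> S1\<close> by auto
    then have "0 \<le> M * T z" "M * T z < M" using \<open>M > 0\<close> by auto
    then show "\<lfloor>M * T z\<rfloor> \<in> {0..<2 ^ n * int P}" by (simp add: floor_less_iff M_def)
  qed
  ultimately have "card E \<le> card {0..<2 ^ n * int P}" by (intro card_inj_on_le) auto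
  then show ?thesis by (simp add: nat_mult_distrib nat_power_eq)
qed

lemma topological_entropy_doubling: "topological_entropy S1 doubling = ereal (ln 2)"
proof (rule antisym)
  show "topological_entropy S1 doubling \<le> ereal (ln 2)"
  proof (rule topological_entropy_le)
    fix \<epsilon> :: real assume "\<epsilon> > 0"
    obtain P where P: "2 * pi / \<epsilon> < real P" using reals_Archimedean2 by blast
    moreover have "0 < 2 * pi / \<epsilon>" using \<open>\<epsilon> > 0\<close> by simp
    ultimately have "real P > 0" by linarith
    then have "P > 0" "2 * pi / real P \<le> \<epsilon>" using P \<open>\<epsilon> > 0\<close> by (simp_all add: field_simps)
    then have "real (card E) \<le> real P * 2 ^ n" if "finite E" "separated S1 doubling n \<epsilon> E" for n E
    proof -
      have "real (card E) \<le> real (2 ^ n * P)"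
        unfolding of_nat_le_iff using that \<open>P > 0\<close> \<open>2 * pi / real P \<le> \<epsilon>\<close> by (rule card_separated_doubling_le)
      then show ?thesis by (simp add: mult.commute)
    qed
    then show "\<exists>C>0. \<forall>n E. finite E \<longrightarrow> separated S1 doubling n \<epsilon> E \<longrightarrow> real (card E) \<le> C * 2 ^ n"
      using \<open>real P > 0\<close> by blast
  qed simp
next
  have "ereal (ln (real 2) / real 1) \<le> topological_entropy S1 doubling"
  proof (rule topological_entropy_ge[where \<epsilon> = 1])
    fix k
    let ?p = "\<lambda>i::int. circle_proj (i / 2 ^ k)"
    have sep: "\<exists>m<k. dist ((doubling ^^ m) (?p i)) ((doubling ^^ m) (?p i')) > 1"
      if "i \<in> {0..<2 ^ k}" "i' \<in> {0..<2 ^ k}" "i \<noteq> i'" for i i'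
    proof -
      have "\<not> 2 ^ k dvd i - i'"
      proof (rule zdvd_not_zless[of "\<bar>i - i'\<bar>" "2 ^ k", unfolded dvd_abs_iff])
        show "0 < \<bar>i - i'\<bar>" using that by simp
        have "i - i' < 2 ^ k" "i' - i < 2 ^ k" using that by auto
        then show "\<bar>i - i'\<bar> < 2 ^ k" by linarith
      qed
      then obtain m where m: "m < k" "circle_proj (2 ^ m * (i / 2 ^ k)) = - circle_proj (2 ^ m * (i' / 2 ^ k))"
        using dyadic_points_become_antipodal by blast
      have "dist (- w) w = 2" if "norm w = 1" for w :: complex
      proof -
        have "dist (- w) w = norm (2 * w)" by (simp add: dist_norm norm_minus_commute)
        then show ?thesis using that by (simp add: norm_mult)
      qed
      then have "dist ((doubling ^^ m) (?p i)) ((doubling ^^ m) (?p i')) = 2"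
        by (simp only: doubling_funpow_circle_proj m(2) norm_circle_proj)
      then show ?thesis using m(1) by (intro exI[of _ m]) simp
    qed
    have "inj_on ?p {0..<2 ^ k}"
    proof (rule inj_onI, rule ccontr)
      fix i i' :: int assume "i \<in> {0..<2 ^ k}" "i' \<in> {0..<2 ^ k}" "?p i = ?p i'" "i \<noteq> i'"
      then show False using sep[of i i'] by auto
    qed
    then have "card (?p ` {0..<2 ^ k}) = 2 ^ k" by (simp add: card_image nat_power_eq)
    moreover have "separated S1 doubling (1 * k) 1 (?p ` {0..<2 ^ k})"
      unfolding separated_def by (auto simp del: funpow.simps intro!: sep)
    ultimately show "\<exists>E. finite E \<and> card E = 2 ^ k \<and> separated S1 doubling (1 * k) 1 E"
      by (intro exI[of _ "?p ` {0..<2 ^ k}"]) simp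
  qed auto
  then show "ereal (ln 2) \<le> topological_entropy S1 doubling" by simp
qed

section \<open>The equivalence\<close>

lemma circle_bounded_variation_iff_lift:
  assumes "circle_lift \<alpha> A"
  shows "circle_bounded_variation \<alpha> \<longleftrightarrow> bounded_variation_on 0 1 A"
proof
  assume "circle_bounded_variation \<alpha>"
  then obtain F where F: "circle_lift \<alpha> F" "bounded_variation_on 0 1 F"
    unfolding circle_bounded_variation_def by blast
  obtain k :: int where "\<And>t. F t = A t + of_int k" using circle_lift_unique[OF F(1) assms] by blast
  then show "bounded_variation_on 0 1 A" using F(2) by (simp add: bounded_variation_on_def)
qed (use assms in \<open>auto simp: circle_bounded_variation_def\<close>)

text \<open>
  A single fold is enough, because the orbits of almost all angles return to its range of values
  infinitely often.
\<close>

lemma (in doubling_semiconjugacy) generic_fibres_if_not_mono: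
  assumes \<alpha>: "circle_lift \<alpha> A" and "\<not> mono A"
  shows "\<exists>\<Lambda>\<subseteq>S1. full_measure \<Lambda> \<and> top_of_set S1 closure_of \<Lambda> = S1 \<and> gdelta_in (top_of_set S1) \<Lambda> \<and>
           (\<forall>\<theta>\<in>\<Lambda>. uncountable (components (S1 \<inter> \<alpha> -` {\<theta>})))"
proof -
  obtain a b where ab: "0 \<le> a" "a < 1" "a < b" "b < a + 1" "A b < A a"
    using fold_within_period[OF assms(2)] by blast
  \<comment> \<open>The arc is cut off so that it does not wrap around the circle.\<close>
  define q where "q = min (A a) (A b + 1 / 2)"
  have q: "A b < q" "q < A b + 1" "q \<le> A a" using ab by (auto simp: q_def)
  define \<Lambda> where "\<Lambda> = {z\<in>S1. \<forall>N. \<exists>n\<ge>N. (doubling ^^ n) z \<in> circle_proj ` {A b<..<q}}"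
  have "uncountable (components (S1 \<inter> \<alpha> -` {\<theta>}))" if \<theta>: "\<theta> \<in> \<Lambda>" for \<theta>
  proof -
    obtain x where x: "\<theta> = circle_proj x" using \<theta> by (metis (no_types, lifting) S1_cases \<Lambda>_def mem_Collect_eq)
    have "\<exists>n\<ge>N. \<exists>m::int. A b + m < 2 ^ n * x \<and> 2 ^ n * x < A a + m" for N
    proof -
      have "\<exists>n\<ge>N. \<exists>m::int. A b + m < 2 ^ n * x \<and> 2 ^ n * x < q + m"
        using \<theta> unfolding \<Lambda>_def x mem_Collect_eq circle_proj_visits_iff by blast
      then obtain n m where "n \<ge> N" "A b + of_int m < 2 ^ n * x" "2 ^ n * x < q + of_int m" by blast
      moreover then have "2 ^ n * x < A a + of_int m" using q(3) by linarith
      ultimately show ?thesis by blast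
    qed
    then show ?thesis unfolding x by (rule uncountable_components_fibre[OF \<alpha> ab(3-5)])
  qed
  moreover have "\<Lambda> \<subseteq> S1" by (auto simp: \<Lambda>_def)
  ultimately show ?thesis
    using infinitely_often_visiting_residual_full_measure[OF q(1,2)] unfolding \<Lambda>_def[symmetric] by blast
qed

theorem theorem1p2:
  fixes g \<alpha> :: "complex \<Rightarrow> complex"
  assumes "continuous_on S1 g" and "g ` S1 \<subseteq> S1"
    and "homotopic_with_canon (\<lambda>_. True) S1 S1 g doubling"
    and "semiconjugacy g \<alpha>"
  shows
    "((\<exists>\<theta>\<in>S1. \<not> connected (S1 \<inter> \<alpha> -` {\<theta>})) \<longleftrightarrow>
      (\<exists>\<Lambda>\<subseteq>S1. full_measure \<Lambda> \<and> top_of_set S1 closure_of \<Lambda> = S1 \<and> gdelta_in (top_of_set S1) \<Lambda> \<and>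
         (\<forall>\<theta>\<in>\<Lambda>. uncountable (components (S1 \<inter> \<alpha> -` {\<theta>}))))) \<and>
     ((\<exists>\<theta>\<in>S1. \<not> connected (S1 \<inter> \<alpha> -` {\<theta>})) \<longleftrightarrow> \<not> circle_bounded_variation \<alpha>) \<and>
     ((\<exists>\<theta>\<in>S1. \<not> connected (S1 \<inter> \<alpha> -` {\<theta>})) \<longrightarrow>
        topological_entropy S1 g > topological_entropy S1 doubling \<and>
        topological_entropy S1 doubling = ereal (ln 2))"
proof -
  let ?a = "\<exists>\<theta>\<in>S1. \<not> connected (S1 \<inter> \<alpha> -` {\<theta>})"
  let ?b = "\<exists>\<Lambda>\<subseteq>S1. full_measure \<Lambda> \<and> top_of_set S1 closure_of \<Lambda> = S1 \<and> gdelta_in (top_of_set S1) \<Lambda> \<and>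
         (\<forall>\<theta>\<in>\<Lambda>. uncountable (components (S1 \<inter> \<alpha> -` {\<theta>})))"
  let ?c = "\<not> circle_bounded_variation \<alpha>"
  let ?entropy = "topological_entropy S1 g > topological_entropy S1 doubling \<and>
        topological_entropy S1 doubling = ereal (ln 2)"
  obtain A G where lifts: "circle_lift \<alpha> A" "circle_lift g G" and "doubling_semiconjugacy A G"
    using semiconjugacy_lift[OF assms(3,4)] by blast
  then interpret doubling_semiconjugacy A G by blast
  have a_imp: "\<not> mono A" if ?a
    using that connected_fibre_if_mono[OF lifts(1)] by blast
  have imp_b: ?b if "\<not> mono A"
    using generic_fibres_if_not_mono[OF lifts(1) that] .
  have b_imp_a: ?a if ?b
  proof -
    from that obtain \<Lambda> where \<Lambda>: "\<Lambda> \<subseteq> S1" "top_of_set S1 closure_of \<Lambda> = S1"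
      "\<And>\<theta>. \<theta> \<in> \<Lambda> \<Longrightarrow> uncountable (components (S1 \<inter> \<alpha> -` {\<theta>}))" by blast
    have "\<Lambda> \<noteq> {}" using \<Lambda>(2) circle_proj_in_S1[of 0] by (metis closure_of_empty empty_iff)
    then obtain \<theta> where \<theta>: "\<theta> \<in> \<Lambda>" by blast
    have "\<not> connected (S1 \<inter> \<alpha> -` {\<theta>})"
    proof
      assume "connected (S1 \<inter> \<alpha> -` {\<theta>})"
      then have "components (S1 \<inter> \<alpha> -` {\<theta>}) \<subseteq> {S1 \<inter> \<alpha> -` {\<theta>}}"
        by (simp add: connected_eq_components_subset_sing)
      then show False using \<Lambda>(3)[OF \<theta>] by (meson countable_insert_eq countable_empty countable_subset)
    qed
    then show ?thesis using \<theta> \<Lambda>(1) by blast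
  qed
  have c_iff: "?c \<longleftrightarrow> \<not> mono A"
    using circle_bounded_variation_iff_lift[OF lifts(1)] bounded_variation_if_mono
      not_bounded_variation_if_not_mono by blast
  have entropy: ?entropy if "\<not> mono A"
    using topological_entropy_gt_if_not_mono[OF lifts(2) that] topological_entropy_doubling by simp
  from a_imp imp_b b_imp_a have "?a \<longleftrightarrow> ?b" "?a \<longleftrightarrow> \<not> mono A" by argo+
  then show ?thesis using c_iff entropy by argo
qed

end
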